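(* For every $n\ge0$, the polynomials $Q_n$ and $Q_{n+1}$ have no common zeros in $S_0\setminus\{0\}$; between any two consecutive zeros of $Q_n$ in $(0,\alpha)$ there is exactly one zero of $Q_{n+1}$, and between any two consecutive zeros of $Q_{n+1}$ in $(0,\alpha)$ there is exactly one zero of $Q_n$. Likewise, for every $n\ge0$, $\Psi_n$ and $\Psi_{n+1}$ have no common zeros in $S_1$; between any two consecutive zeros of $\Psi_n$ in $(-b,-a)$ there is exactly one zero of $\Psi_{n+1}$, and vice versa.
   Context: Fix real numbers $0<\alpha<\infty$ and $0<a<b<\infty$, and let $\omega=e^{2\pi i/3}$. Let $S_0=\bigcup_{k=0}^{2}\omega^k[0,\alpha]$ and $S_1=\bigcup_{k=0}^{2}\omega^k[-b,-a]$. Let $s_1:S_0\to\mathbb{C}$ satisfy $s_1\ge 0$ on $(0,\alpha)$, $s_1\in L^1(0,\alpha)$, $s_1$ not a.e. zero on $(0,\alpha)$, and $s_1(\omega z)=\omega^2 s_1(z)$ for $z\in S_0\setminus\{0,\alpha,\omega\alpha,\omega^2\alpha\}$. For a function $g$ on $S_0$, $\int_{S_0}g(t)s_1(t)\,dt$ denotes the complex line integral along the three segments oriented from $0$ outward; by the symmetry of $s_1$ it equals $\sum_{k=0}^{2}\int_0^\alpha g(\omega^k x)s_1(x)\,dx$. Let $s_2\ge 0$ be integrable on $[-b,-a]$ and not a.e. zero, and put $f(z)=z^2\int_{-b}^{-a}\frac{s_2(t)}{z^3-t^3}\,dt$. For $n\ge0$, $Q_n$ denotes the monic polynomial of lowest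 degree such that $\int_{S_0}Q_{2n}(t)t^ks_1(t)dt=0$ and $\int_{S_0}Q_{2n}(t)t^kf(t)s_1(t)dt=0$ for $0\le k\le n-1$; and $\int_{S_0}Q_{2n+1}(t)t^ks_1(t)dt=0$ for $0\le k\le n$, $\int_{S_0}Q_{2n+1}(t)t^kf(t)s_1(t)dt=0$ for $0\le k\le n-1$. The functions of second type are $\Psi_n(z)=\int_{S_0}\frac{Q_n(t)}{t-z}s_1(t)\,dt$, $z\in\mathbb{C}\setminus S_0$. *)

theory Defs
  imports "HOL-Analysis.Analysis" "HOL-Computational_Algebra.Polynomial"
begin

definition omega :: complex where
  "omega = cis (2 * pi / 3)"

definition S0 :: "real \<Rightarrow> complex set" where
  "S0 \<alpha> = {omega ^ k * complex_of_real x | k x. k < 3 \<and> 0 \<le> x \<and> x \<le> \<alpha>}"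

definition S1 :: "real \<Rightarrow> real \<Rightarrow> complex set" where
  "S1 a b = {omega ^ k * complex_of_real x | k x. k < 3 \<and> -b \<le> x \<and> x \<le> -a}"

text \<open>The line integral over S0 against s1 (segments oriented outward); by the
  symmetry s1(omega z) = omega^2 s1(z) it equals the sum over k of the integrals
  of g(omega^k x) s1(x) over (0,alpha).  Here s1 denotes the restriction of the
  weight to the positive ray (0,alpha), which determines it on S0.\<close>
definition intS0 :: "real \<Rightarrow> (real \<Rightarrow> real) \<Rightarrow> (complex \<Rightarrow> complex) \<Rightarrow> complex" where
  "intS0 \<alpha> s1 g = (\<Sum>k<3. LINT x:{0<..<\<alpha>}|lborel.
       g (omega ^ k * complex_of_real x) * complex_of_real (s1 x))"

definition fM :: "real \<Rightarrow> real \<Rightarrow> (real \<Rightarrow> real) \<Rightarrow> complex \<Rightarrow> complex" where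
  "fM a b s2 z = z ^ 2 * (LINT t:{-b..-a}|lborel.
       complex_of_real (s2 t) / (z ^ 3 - (complex_of_real t) ^ 3))"

definition Qcond :: "real \<Rightarrow> (real \<Rightarrow> real) \<Rightarrow> (complex \<Rightarrow> complex) \<Rightarrow> nat \<Rightarrow> complex poly \<Rightarrow> bool" where
  "Qcond \<alpha> s1 f n q =
     (if even n then
        (\<forall>k < n div 2. intS0 \<alpha> s1 (\<lambda>t. poly q t * t ^ k) = 0) \<and>
        (\<forall>k < n div 2. intS0 \<alpha> s1 (\<lambda>t. poly q t * t ^ k * f t) = 0)
      else
        (\<forall>k \<le> n div 2. intS0 \<alpha> s1 (\<lambda>t. poly q t * t ^ k) = 0) \<and>
        (\<forall>k < n div 2. intS0 \<alpha> s1 (\<lambda>t. poly q t * t ^ k * f t) = 0))"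

definition Qpoly :: "real \<Rightarrow> (real \<Rightarrow> real) \<Rightarrow> (complex \<Rightarrow> complex) \<Rightarrow> nat \<Rightarrow> complex poly" where
  "Qpoly \<alpha> s1 f n = (SOME q. lead_coeff q = 1 \<and> Qcond \<alpha> s1 f n q \<and>
       (\<forall>p. lead_coeff p = 1 \<and> Qcond \<alpha> s1 f n p \<longrightarrow> degree q \<le> degree p))"

definition Psi :: "real \<Rightarrow> (real \<Rightarrow> real) \<Rightarrow> (complex \<Rightarrow> complex) \<Rightarrow> nat \<Rightarrow> complex \<Rightarrow> complex" where
  "Psi \<alpha> s1 f n z = intS0 \<alpha> s1 (\<lambda>t. poly (Qpoly \<alpha> s1 f n) t / (t - z))"

definition consec_zeros :: "(real \<Rightarrow> complex) \<Rightarrow> real set \<Rightarrow> real \<Rightarrow> real \<Rightarrow> bool" where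
  "consec_zeros g I x y \<longleftrightarrow> x < y \<and> x \<in> I \<and> y \<in> I \<and> g x = 0 \<and> g y = 0 \<and>
      (\<forall>z. x < z \<and> z < y \<longrightarrow> g z \<noteq> 0)"

end

theory Submission
  imports Defs
begin

text \<open>
  Write \<open>Q\<^sub>n(z) = z\<^sup>l q\<^sub>n(z\<^sup>3)\<close> with \<open>l = n mod 3\<close>. Under \<open>x = z\<^sup>3\<close> the two measures become \<open>M\<close> on
  \<open>(0, \<alpha>\<^sup>3)\<close> and \<open>N\<close> on \<open>[-b\<^sup>3, -a\<^sup>3]\<close>, and \<open>q\<^sub>n\<close> is orthogonal with respect to \<open>M\<close> to consecutive powers
  of \<open>x\<close> and to consecutive powers times the Markov function of \<open>N\<close>; the second kind of relation says that
  the Cauchy transform of \<open>q\<^sub>n dM\<close> is orthogonal to powers with respect to \<open>N\<close>. This transform is therefore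
  divisible by a polynomial \<open>W\<close> with many negative zeros, and then \<open>q\<^sub>n\<close> is orthogonal to all polynomials
  of low degree with respect to the positive measure \<open>dM / W\<close>. Testing with \<open>q\<^sub>n\<close> itself gives
  normality. The nontrivial real combinations of two consecutive polynomials, after multiplying one of them
  by \<open>x\<close> where needed, miss only one relation, so testing with \<open>h / (x - c)\<^sup>2\<close> shows that neither such
  a combination \<open>h\<close> nor its Cauchy transform has a double zero. By Rolle's theorem for quotients this
  forces interlacing.
\<close>

section \<open>Pairs of positive measures on opposite half-lines\<close>

text \<open>Averaging over the three rays kills every power not divisible by three, so a relation
  against \<open>t ^ k\<close> sees only one residue class of coefficients. For
  \<open>z ^ l * q (z ^ 3)\<close> the surviving relations start at the exponent l / 3 rounded up
  or, because of the factor \<open>z ^ 2\<close> in f, at (l + 2) / 3 rounded up; these are the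
  offsets \<open>e\<close> and \<open>e'\<close>. A Markov relation becomes a relation on N only
  after powers of x are pulled out of the Cauchy transform, at the price of one vanishing moment per
  power; the recurring condition \<open>s + e' <= r + 1 + e\<close> says that there are enough of
  them. The offsets vary with n mod 3, so consecutive polynomials must be brought to common offsets
  and equal degree before a pencil can be tested. The weight 1 / W depends on the combination under
  study. Taking W of maximal degree avoids counting zeros: positivity of an integral against M
  bounds the degree of W from above, positivity of an integral against N bounds it from
  below.\<close>

locale nikishin_pair =
  fixes M N :: "real measure" and c a b :: real
  assumes finM: "finite_measure M" and setsM [measurable_cong, simp]: "sets M = sets borel"
    and suppM: "AE x in M. x \<in> {0<..<c}"
    and infM: "finite S \<Longrightarrow> \<not> (AE x in M. x \<in> S)"
    and finN: "finite_measure N" and setsN [measurable_cong, simp]: "sets N = sets borel"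
    and suppN: "AE t in N. t \<in> {-b..-a}" and a_pos: "0 < a"
    and infN: "finite S \<Longrightarrow> \<not> (AE t in N. t \<in> S)"
begin

lemma measurable_poly [measurable]: "(\<lambda>x::real. poly p x) \<in> borel_measurable borel"
  by (intro borel_measurable_continuous_onI continuous_intros)

lemma integrable_continuous_M:
  assumes "continuous_on {0..c} g" "g \<in> borel_measurable borel"
  shows "integrable M (g :: real \<Rightarrow> real)"
proof -
  interpret finite_measure M by (rule finM)
  have "bounded (g ` {0..c})" using assms(1) by (intro compact_imp_bounded compact_continuous_image) auto
  then obtain B where B: "\<And>x. x \<in> {0..c} \<Longrightarrow> norm (g x) \<le> B" 
    unfolding bounded_iff by blast
  show ?thesis
  proof (rule integrable_const_bound[where B=B])
    show "AE x in M. norm (g x) \<le> B" using suppM by eventually_elim (use B in force)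
  qed (use assms in measurable)
qed

definition nonneg_free :: "real poly \<Rightarrow> bool" where
  "nonneg_free W \<longleftrightarrow> (\<forall>x\<ge>0. poly W x > 0)"

lemma integrable_quot:
  assumes "nonneg_free W" shows "integrable M (\<lambda>x. poly p x / poly W x)"
  by (rule integrable_continuous_M)
     (use assms in \<open>force simp: nonneg_free_def intro!: continuous_intros\<close>, measurable)

lemma integrable_poly: "integrable M (poly p)"
  by (rule integrable_continuous_M) (auto intro!: continuous_intros)

section \<open>Cauchy transforms with a polynomial in the denominator of the weight\<close>

definition cauchy :: "real poly \<Rightarrow> real poly \<Rightarrow> real \<Rightarrow> real" where
  "cauchy W p z = (\<integral>x. poly p x / (poly W x * (x - z)) \<partial>M)"

lemma nonneg_free_mult_linear:
  "nonneg_free W \<Longrightarrow> z < 0 \<Longrightarrow> nonneg_free (W * [:-z, 1:])"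
  by (auto simp: nonneg_free_def)

lemma integrable_cauchy:
  assumes "nonneg_free W" "z < 0"
  shows "integrable M (\<lambda>x. poly p x / (poly W x * (x - z)))"
  using integrable_quot[OF nonneg_free_mult_linear[OF assms]] by (simp add: algebra_simps)

text \<open>The resolvent identity 1/(x-y) - 1/(x-z) = (y-z)/((x-y)(x-z)). A difference quotient is
  again a Cauchy transform, with the new factor absorbed into \<open>W\<close>; continuity,
  differentiability and division by zeros all come from this.\<close>

lemma cauchy_diff:
  assumes "nonneg_free W" "z < 0" "y < 0"
  shows "cauchy W p y - cauchy W p z = (y - z) * cauchy (W * [:-z, 1:]) p y"
proof -
  have "cauchy W p y - cauchy W p z
      = (\<integral>x. poly p x / (poly W x * (x - y)) - poly p x / (poly W x * (x - z)) \<partial>M)"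
    unfolding cauchy_def using assms by (intro Bochner_Integration.integral_diff[symmetric] integrable_cauchy)
  also have "\<dots> = (\<integral>x. (y - z) * (poly p x / (poly (W * [:-z, 1:]) x * (x - y))) \<partial>M)"
  proof (rule integral_cong_AE)
    show "AE x in M. poly p x / (poly W x * (x - y)) - poly p x / (poly W x * (x - z)) =
        (y - z) * (poly p x / (poly (W * [:- z, 1:]) x * (x - y)))"
      using suppM
    proof eventually_elim
      case (elim x)
      then have "poly W x \<noteq> 0" "x - y \<noteq> 0" "x - z \<noteq> 0" using assms by (auto simp: nonneg_free_def less_le)
      moreover have "poly (W * [:- z, 1:]) x = poly W x * (x - z)" by (simp add: algebra_simps)
      ultimately show ?case by (simp add: divide_simps) (simp add: algebra_simps)
    qed
  qed measurable
  finally show ?thesis unfolding cauchy_def by (simp only: integral_mult_right_zero)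
qed

text \<open>For y < z < 0 < x the kernel 1/(x-y) is at most 1/(x-z). The bound serves as a Lipschitz
  constant in the proof of continuity.\<close>

lemma cauchy_bound:
  assumes "nonneg_free W" "z < 0"
  shows "\<exists>B. \<forall>y<z. \<bar>cauchy W p y\<bar> \<le> B"
proof (intro exI allI impI)
  fix y assume y: "y < z"
  have "norm (cauchy W p y) \<le> (\<integral>x. norm (poly p x / (poly W x * (x - y))) \<partial>M)"
    unfolding cauchy_def by (rule integral_norm_bound)
  also have "\<dots> \<le> (\<integral>x. norm (poly p x / (poly W x * (x - z))) \<partial>M)"
  proof (rule integral_mono_AE)
    show "AE x in M. norm (poly p x / (poly W x * (x - y))) \<le> norm (poly p x / (poly W x * (x - z)))"
      using suppM
    proof eventually_elim
      case (elim x)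
      then have "poly W x > 0" "x - z > 0" "x - y \<ge> x - z" using assms y by (auto simp: nonneg_free_def)
      then show ?case by (simp add: abs_mult) (intro divide_left_mono mult_left_mono mult_pos_pos, auto)
    qed
  qed (use assms y in \<open>intro integrable_norm integrable_cauchy; simp\<close>)+
  finally show "\<bar>cauchy W p y\<bar> \<le> (\<integral>x. norm (poly p x / (poly W x * (x - z))) \<partial>M)" by simp
qed

lemma cauchy_isCont:
  assumes "nonneg_free W" "z < 0" shows "isCont (cauchy W p) z"
proof -
  \<comment> \<open>As z is negative, \<open>z/2\<close> lies to its right, so the bound covers a
    neighbourhood of z.\<close>
  from cauchy_bound[OF nonneg_free_mult_linear[OF assms], of "z/2" p] assms
  obtain B where B: "\<And>y. y < z/2 \<Longrightarrow> \<bar>cauchy (W * [:-z, 1:]) p y\<bar> \<le> B" by auto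
  have "((\<lambda>y. cauchy W p y - cauchy W p z) \<longlongrightarrow> 0) (at z)"
  proof (rule Lim_null_comparison)
    have "\<forall>\<^sub>F y in at z. y < z/2" using assms by (intro order_tendstoD) (auto intro!: tendsto_eq_intros)
    then show "\<forall>\<^sub>F y in at z. norm (cauchy W p y - cauchy W p z) \<le> \<bar>y - z\<bar> * B"
    proof eventually_elim
      case (elim y)
      then have "y < 0" using assms by auto
      then show ?case using cauchy_diff[OF assms, of y p] B[OF elim] by (simp add: abs_mult mult_left_mono)
    qed
    show "((\<lambda>y. \<bar>y - z\<bar> * B) \<longlongrightarrow> 0) (at z)" by (auto intro!: tendsto_eq_intros)
  qed
  then show ?thesis unfolding isCont_def by (simp add: Lim_null[symmetric])
qed

lemma cauchy_deriv:
  assumes "nonneg_free W" "z < 0"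
  shows "(cauchy W p has_real_derivative cauchy (W * [:-z, 1:]) p z) (at z)"
  unfolding has_field_derivative_iff
proof (rule Lim_transform_eventually)
  show "(cauchy (W * [:-z, 1:]) p \<longlongrightarrow> cauchy (W * [:-z, 1:]) p z) (at z)"
    using cauchy_isCont[OF nonneg_free_mult_linear[OF assms] assms(2)] by (simp add: isCont_def)
  have "\<forall>\<^sub>F y in at z. y < 0" using assms by (intro order_tendstoD) (auto intro!: tendsto_eq_intros)
  moreover have "\<forall>\<^sub>F y in at z. y \<noteq> z" by (simp add: eventually_at_filter)
  ultimately show "\<forall>\<^sub>F y in at z. cauchy (W * [:-z, 1:]) p y = (cauchy W p y - cauchy W p z) / (y - z)"
    by eventually_elim (use cauchy_diff[OF assms] in auto)
qed

text \<open>If the Cauchy transform of \<open>H dM\<close> vanishes at the negative zeros of \<open>W\<close>, dividing it by \<open>W\<close>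
  amounts to replacing the weight \<open>dM\<close> by \<open>dM / W\<close>, and every such zero yields one more
  orthogonality relation for \<open>H\<close>.\<close>

definition divides_cauchy :: "nat \<Rightarrow> real poly \<Rightarrow> real poly \<Rightarrow> bool" where
  "divides_cauchy r H W \<longleftrightarrow> nonneg_free W \<and> (\<forall>z<0. cauchy 1 H z = poly W z * cauchy W H z) \<and>
     (\<forall>p. degree p < r + degree W \<longrightarrow> (\<integral>x. poly (H * p) x / poly W x \<partial>M) = 0)"

lemma integral_poly_sum:
  assumes "integrable M (\<lambda>x. G x)" "\<And>j. integrable M (\<lambda>x. G x * x ^ j)"
  shows "(\<integral>x. G x * poly p x \<partial>M) = (\<Sum>j\<le>degree p. coeff p j * (\<integral>x. G x * x ^ j \<partial>M))"
proof -
  have "(\<integral>x. G x * poly p x \<partial>M) = (\<integral>x. (\<Sum>j\<le>degree p. coeff p j * (G x * x ^ j)) \<partial>M)"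
    by (simp add: poly_altdef sum_distrib_left mult_ac)
  also have "\<dots> = (\<Sum>j\<le>degree p. \<integral>x. coeff p j * (G x * x ^ j) \<partial>M)"
    by (intro Bochner_Integration.integral_sum integrable_mult_right assms)
  finally show ?thesis by simp
qed

lemma divides_cauchy_1:
  assumes "\<And>j. j < r \<Longrightarrow> (\<integral>x. poly H x * x ^ j \<partial>M) = 0"
  shows "divides_cauchy r H 1"
proof -
  have "(\<integral>x. poly H x * poly p x \<partial>M) = 0" if "degree p < r" for p
  proof -
    have "integrable M (\<lambda>x. poly H x * x ^ j)" for j
      by (intro integrable_continuous_M) (auto intro!: continuous_intros)
    then show ?thesis by (subst integral_poly_sum) (use that assms in \<open>auto intro: integrable_poly\<close>)
  qed
  then show ?thesis by (auto simp: divides_cauchy_def nonneg_free_def)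
qed

text \<open>Dividing the test polynomial by x - z splits its integral into one with weight 1 / W and
  a test polynomial of smaller degree, and a multiple of \<open>cauchy W H z\<close>. Both vanish,
  which yields the additional relation.\<close>

lemma divides_cauchy_step:
  assumes W: "divides_cauchy r H W" and z: "z < 0" "cauchy W H z = 0"
  shows "divides_cauchy r H (W * [:-z, 1:])"
proof -
  have nf: "nonneg_free W" using W by (simp add: divides_cauchy_def)
  then have W0: "W \<noteq> 0" by (auto simp: nonneg_free_def)
  have nf': "nonneg_free (W * [:-z, 1:])" using nf z by (intro nonneg_free_mult_linear)
  have "degree (W * [:-z, 1:]) = Suc (degree W)" using W0 by (subst degree_mult_eq) auto
  moreover have "(\<integral>x. poly (H * p) x / poly (W * [:-z, 1:]) x \<partial>M) = 0"
    if p: "degree p < Suc (r + degree W)" for p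
  proof -
    define g where "g = synthetic_div p z"
    have pg: "p = [:-z, 1:] * g + [:poly p z:]" unfolding g_def using synthetic_div_correct'[of z p] by simp
    have g: "(\<integral>x. poly (H * g) x / poly W x \<partial>M) = 0"
    \<comment> \<open>Constants need their own case: \<open>r + degree W\<close> may be 0, and then
      no degree lies below it.\<close>
    proof (cases "degree p = 0")
      case True
      then have "g = 0" unfolding g_def by (simp add: synthetic_div_eq_0_iff)
      then show ?thesis by simp
    next
      case False
      then have "degree g < r + degree W" using p by (simp add: g_def degree_synthetic_div)
      then show ?thesis using W by (simp add: divides_cauchy_def)
    qed
    have "(\<integral>x. poly (H * p) x / poly (W * [:-z, 1:]) x \<partial>M)
       = (\<integral>x. poly (H * g) x / poly W x + poly p z * (poly H x / (poly W x * (x - z))) \<partial>M)"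
    proof (rule integral_cong_AE)
      show "AE x in M. poly (H * p) x / poly (W * [:- z, 1:]) x =
          poly (H * g) x / poly W x + poly p z * (poly H x / (poly W x * (x - z)))"
        using suppM
      proof eventually_elim
        case (elim x)
        then have "poly W x \<noteq> 0" "x - z \<noteq> 0" using nf z by (auto simp: nonneg_free_def less_le)
        moreover have "poly p x = (x - z) * poly g x + poly p z" by (subst pg) (simp add: algebra_simps)
        moreover have "poly (W * [:- z, 1:]) x = poly W x * (x - z)" by (simp add: algebra_simps)
        ultimately show ?case by (simp add: divide_simps) (simp add: algebra_simps)
      qed
    qed measurable
    also have "\<dots> = 0"
    proof (subst Bochner_Integration.integral_add)
      show "(\<integral>x. poly (H * g) x / poly W x \<partial>M) + (\<integral>x. poly p z * (poly H x / (poly W x * (x - z))) \<partial>M) = 0"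
        unfolding g integral_mult_right_zero cauchy_def[symmetric] z by simp
    qed (use nf z in \<open>intro integrable_mult_right integrable_quot integrable_cauchy; simp\<close>)+
    finally show ?thesis .
  qed
  moreover have "cauchy 1 H y = poly (W * [:-z, 1:]) y * cauchy (W * [:-z, 1:]) H y" if "y < 0" for y
  proof -
    have "cauchy W H y = poly [:-z, 1:] y * cauchy (W * [:-z, 1:]) H y"
      using cauchy_diff[OF nf z(1) that, of H] z(2) by simp
    moreover have "cauchy 1 H y = poly W y * cauchy W H y" using W that by (simp add: divides_cauchy_def)
    ultimately show ?thesis by (simp only: poly_mult mult.assoc)
  qed
  ultimately show ?thesis using nf' by (simp add: divides_cauchy_def)
qed

section \<open>Positivity tests against dM / W and the divisor of maximal degree\<close>

lemma poly_eq_0_AE_M: "AE x in M. poly p x = 0 \<Longrightarrow> p = 0"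
  using infM[OF poly_roots_finite, of p] by auto

lemma poly_eq_0_AE_N: "AE x in N. poly p x = 0 \<Longrightarrow> p = 0"
  using infN[OF poly_roots_finite, of p] by auto

text \<open>On the support of M both \<open>x ^ e\<close> and 1 / W are positive, so a nonnegative
  \<open>h * g\<close> with vanishing integral is zero almost everywhere, hence at infinitely many
  points. The power \<open>monom 1 e\<close> belongs to the weight and is kept apart from
  \<open>h\<close> so that it does not enter the degree bounds.\<close>

lemma test_eq_0:
  assumes W: "divides_cauchy r (monom 1 e * h) W" and g: "degree g < r + degree W"
    and pos: "\<And>x. poly h x * poly g x \<ge> 0"
  shows "h * g = 0"
proof -
  have nf: "nonneg_free W" using W by (simp add: divides_cauchy_def)
  have "(\<integral>x. poly (monom 1 e * h * g) x / poly W x \<partial>M) = 0"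
    using W g by (simp add: divides_cauchy_def del: poly_mult)
  moreover have "AE x in M. poly (monom 1 e * h * g) x / poly W x \<ge> 0"
    using suppM by eventually_elim (use nf pos in \<open>auto simp: nonneg_free_def less_imp_le poly_monom mult.assoc\<close>)
  ultimately have "AE x in M. poly (monom 1 e * h * g) x / poly W x = 0"
    using integral_nonneg_eq_0_iff_AE[OF integrable_quot[OF nf]] by blast
  then have "AE x in M. poly (h * g) x = 0"
    using suppM
  proof eventually_elim
    case (elim x)
    then have "poly W x > 0" "x > 0" using nf by (auto simp: nonneg_free_def)
    then show ?case using elim by (simp add: poly_monom)
  qed
  then show ?thesis by (rule poly_eq_0_AE_M)
qed

lemma degree_bound:
  assumes "divides_cauchy r (monom 1 e * h) W" "h \<noteq> 0"
  shows "r + degree W \<le> degree h"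
  using test_eq_0[OF assms(1), of h] assms(2) by fastforce

text \<open>A negative zero of \<open>cauchy W\<close> could be moved into \<open>W\<close> by
  \<open>divides_cauchy_step\<close>, and \<open>degree_bound\<close> limits how often.
  Multiplicities take care of themselves, because a repeated zero is still a zero of the
  quotient.\<close>

lemma maximal_divisor:
  assumes "\<And>j. j < r \<Longrightarrow> (\<integral>x. poly (monom 1 e * h) x * x ^ j \<partial>M) = 0" and "h \<noteq> 0"
  obtains W where "divides_cauchy r (monom 1 e * h) W" "\<And>z. z < 0 \<Longrightarrow> cauchy W (monom 1 e * h) z \<noteq> 0"
proof -
  define P where "P = (\<lambda>k. \<exists>W. divides_cauchy r (monom 1 e * h) W \<and> degree W = k)"
  have "P 0" unfolding P_def using divides_cauchy_1[of r "monom 1 e * h"] assms(1) degree_1 by blast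
  moreover have bd: "\<And>k. P k \<Longrightarrow> k \<le> degree h" unfolding P_def using degree_bound assms(2) by fastforce
  ultimately have "\<exists>k. P k \<and> (\<forall>j. P j \<longrightarrow> j \<le> k)" by (intro Nat.ex_has_greatest_nat[of P 0 "degree h"]) auto
  then obtain k where k: "P k" "\<And>j. P j \<Longrightarrow> j \<le> k" by auto
  then obtain W where W: "divides_cauchy r (monom 1 e * h) W" "degree W = k" by (auto simp: P_def)
  then have W0: "W \<noteq> 0" by (auto simp: divides_cauchy_def nonneg_free_def)
  have "cauchy W (monom 1 e * h) z \<noteq> 0" if "z < 0" for z
  proof
    assume "cauchy W (monom 1 e * h) z = 0"
    from divides_cauchy_step[OF W(1) that this] have "P (degree (W * [:-z, 1:]))" unfolding P_def by blast
    moreover have "degree (W * [:-z, 1:]) = Suc (degree W)" using W0 by (subst degree_mult_eq) auto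
    ultimately show False using k(2) W(2) by fastforce
  qed
  with W(1) show ?thesis by (rule that)
qed

section \<open>The Markov function of N and its moments against M\<close>

definition markov :: "real \<Rightarrow> real" where "markov x = (\<integral>t. 1 / (x - t) \<partial>N)"

definition moment :: "real poly \<Rightarrow> nat \<Rightarrow> real" where "moment h m = (\<integral>x. poly h x * x ^ m \<partial>M)"

definition markov_moment :: "real poly \<Rightarrow> nat \<Rightarrow> real" where "markov_moment h m = (\<integral>x. poly h x * x ^ m * markov x \<partial>M)"

lemma markov_measurable [measurable]: "markov \<in> borel_measurable borel"
proof -
  interpret N: finite_measure N by (rule finN)
  show ?thesis unfolding markov_def by measurable
qed

lemma integrable_N_kernel:
  assumes "x > 0" shows "integrable N (\<lambda>t. 1 / (x - t))"
proof -
  interpret N: finite_measure N by (rule finN)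
  show ?thesis
  proof (rule N.integrable_const_bound[where B="1/a"])
    show "AE t in N. norm (1 / (x - t)) \<le> 1 / a"
      using suppN by eventually_elim (use a_pos assms in \<open>auto simp: frac_le\<close>)
  qed measurable
qed

text \<open>The supports of M and N are at distance at least a, so the kernel is bounded by 1 / a
  and a multiple of the polynomial dominates the inner integral.\<close>

lemma integrable_pair_kernel:
  "integrable (M \<Otimes>\<^sub>M N) (\<lambda>(x, t). poly h x * (1 / (x - t)))"
proof -
  interpret M: finite_measure M by (rule finM)
  interpret N: finite_measure N by (rule finN)
  interpret pair_sigma_finite M N ..
  show ?thesis
  proof (rule Fubini_integrable)
    have bound: "integrable M (\<lambda>x. \<bar>poly h x\<bar> * markov x)"
    proof (rule Bochner_Integration.integrable_bound)
      show "integrable M (\<lambda>x. \<bar>poly h x\<bar> * (measure N (space N) / a))"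
        by (intro integrable_mult_left integrable_abs integrable_poly)
      show "AE x in M. norm (\<bar>poly h x\<bar> * markov x) \<le> norm (\<bar>poly h x\<bar> * (measure N (space N) / a))"
        using suppM
      proof eventually_elim
        case (elim x)
        have "AE t in N. norm (1 / (x - t)) \<le> 1 / a"
          using suppN by eventually_elim (use a_pos elim in \<open>auto simp: frac_le\<close>)
        with elim have "(\<integral>t. norm (1 / (x - t)) \<partial>N) \<le> (\<integral>t. 1 / a \<partial>N)"
          by (intro integral_mono_AE integrable_norm integrable_N_kernel) auto
        then have "norm (markov x) \<le> (\<integral>t. 1 / a \<partial>N)"
          unfolding markov_def by (rule order_trans[OF integral_norm_bound])
        then show ?case using a_pos mult_left_mono[of "\<bar>markov x\<bar>" "measure N (space N) / a" "\<bar>poly h x\<bar>"]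
          by (simp add: abs_mult)
      qed
    qed measurable
    have "AE x in M. \<bar>poly h x\<bar> * markov x = (\<integral>t. norm (case (x, t) of (x, t) \<Rightarrow> poly h x * (1 / (x - t))) \<partial>N)"
      using suppM
    proof eventually_elim
      case (elim x)
      have "AE t in N. norm (poly h x * (1 / (x - t))) = \<bar>poly h x\<bar> * (1 / (x - t))"
        using suppN
      proof eventually_elim
        case t: (elim t)
        then have "x - t > 0" using a_pos elim by auto
        then show ?case by (simp add: abs_mult)
      qed
      then have "(\<integral>t. norm (poly h x * (1 / (x - t))) \<partial>N) = (\<integral>t. \<bar>poly h x\<bar> * (1 / (x - t)) \<partial>N)"
        by (intro integral_cong_AE) measurable
      then show ?case unfolding markov_def prod.case integral_mult_right_zero by (rule sym)
    qed
    then show "integrable M (\<lambda>x. \<integral>t. norm (case (x, t) of (x, t) \<Rightarrow> poly h x * (1 / (x - t))) \<partial>N)"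
      by (rule integrable_cong_AE_imp[OF bound, rotated]) measurable
    show "AE x in M. integrable N (\<lambda>t. case (x, t) of (x, t) \<Rightarrow> poly h x * (1 / (x - t)))"
      using suppM
    proof eventually_elim
      case (elim x)
      then show ?case unfolding prod.case by (intro integrable_mult_right integrable_N_kernel) simp
    qed
  qed measurable
qed

lemma integrable_markov: "integrable M (\<lambda>x. poly h x * markov x)"
proof -
  interpret M: finite_measure M by (rule finM)
  interpret N: finite_measure N by (rule finN)
  interpret pair_sigma_finite M N ..
  have "integrable M (\<lambda>x. \<integral>t. poly h x * (1 / (x - t)) \<partial>N)"
    using integrable_fst'[OF integrable_pair_kernel[of h]] by simp
  then show ?thesis by (simp only: markov_def integral_mult_right_zero)
qed

text \<open>Fubini turns the Markov function from a factor under M into a second integration, so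
  that a Markov relation becomes a statement about N alone.\<close>

lemma markov_moment_eq_cauchy:
  "markov_moment h m = (\<integral>t. cauchy 1 (monom 1 m * h) t \<partial>N)" and
  integrable_N_cauchy: "integrable N (\<lambda>t. cauchy 1 (monom 1 m * h) t)"
proof -
  interpret M: finite_measure M by (rule finM)
  interpret N: finite_measure N by (rule finN)
  interpret pair_sigma_finite M N ..
  have "markov_moment h m = (\<integral>x. (\<integral>t. poly (monom 1 m * h) x * (1 / (x - t)) \<partial>N) \<partial>M)"
    unfolding markov_moment_def markov_def integral_mult_right_zero by (simp add: poly_monom mult_ac)
  also have "\<dots> = (\<integral>t. (\<integral>x. poly (monom 1 m * h) x * (1 / (x - t)) \<partial>M) \<partial>N)"
    using Fubini_integral[OF integrable_pair_kernel[of "monom 1 m * h"]] by simp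
  finally show "markov_moment h m = (\<integral>t. cauchy 1 (monom 1 m * h) t \<partial>N)" by (simp add: cauchy_def)
  show "integrable N (\<lambda>t. cauchy 1 (monom 1 m * h) t)"
    using integrable_snd[OF integrable_pair_kernel[of "monom 1 m * h"]] by (simp add: cauchy_def)
qed

text \<open>Integrated form of x/(x-z) = 1 + z/(x-z): a power of x leaves the transform as a power
  of z as soon as the moment vanishes.\<close>

lemma cauchy_monom_Suc:
  assumes "z < 0"
  shows "cauchy 1 (monom 1 (Suc m) * h) z = moment h m + z * cauchy 1 (monom 1 m * h) z"
proof -
  have "cauchy 1 (monom 1 (Suc m) * h) z
     = (\<integral>x. poly h x * x ^ m + z * (poly (monom 1 m * h) x / (poly 1 x * (x - z))) \<partial>M)"
    unfolding cauchy_def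
  proof (rule integral_cong_AE)
    show "AE x in M. poly (monom 1 (Suc m) * h) x / (poly 1 x * (x - z)) =
        poly h x * x ^ m + z * (poly (monom 1 m * h) x / (poly 1 x * (x - z)))"
      using suppM by eventually_elim (use assms in \<open>auto simp: poly_monom field_simps\<close>)
  qed measurable
  also have "\<dots> = moment h m + z * cauchy 1 (monom 1 m * h) z"
    unfolding cauchy_def moment_def
  proof (subst Bochner_Integration.integral_add)
    show "integrable M (\<lambda>x. poly h x * x ^ m)"
      by (intro integrable_continuous_M) (auto intro!: continuous_intros)
    show "integrable M (\<lambda>x. z * (poly (monom 1 m * h) x / (poly 1 x * (x - z))))"
      using assms by (intro integrable_mult_right integrable_cauchy) (auto simp: nonneg_free_def)
    show "(\<integral>x. poly h x * x ^ m \<partial>M) + (\<integral>x. z * (poly (monom 1 m * h) x / (poly 1 x * (x - z))) \<partial>M) =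
        (\<integral>x. poly h x * x ^ m \<partial>M) + z * (\<integral>x. poly (monom 1 m * h) x / (poly 1 x * (x - z)) \<partial>M)"
      unfolding integral_mult_right_zero ..
  qed
  finally show ?thesis .
qed

section \<open>Mixed orthogonality, normality and simple zeros\<close>

definition moment_orth :: "nat \<Rightarrow> nat \<Rightarrow> nat \<Rightarrow> nat \<Rightarrow> real poly \<Rightarrow> bool" where
  "moment_orth e e' r s h \<longleftrightarrow> (\<forall>m. e \<le> m \<and> m < e + r \<longrightarrow> moment h m = 0) \<and> (\<forall>m. e' \<le> m \<and> m < e' + s \<longrightarrow> markov_moment h m = 0)"

lemma cauchy_power:
  assumes "moment_orth e e' r s h" "j \<le> r" "z < 0"
  shows "cauchy 1 (monom 1 (e + j) * h) z = z ^ j * cauchy 1 (monom 1 e * h) z"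
  using assms(2)
proof (induction j)
  case (Suc j)
  then have "moment h (e + j) = 0" using assms(1) by (auto simp: moment_orth_def)
  then show ?case using cauchy_monom_Suc[OF assms(3), of "e + j" h] Suc by (simp add: mult_ac)
qed simp

text \<open>Passing from exponent \<open>e\<close> to \<open>e' + j\<close> with j < s consumes
  \<open>j + (e' - e)\<close> vanishing moments; the third premise guarantees that at least so many
  are available. The remaining power \<open>t ^ (e' - e)\<close> has constant sign on the negative
  axis and does no harm.\<close>

lemma cauchy_orth:
  assumes "moment_orth e e' r s h" "e \<le> e'" "s + e' \<le> r + 1 + e" "degree p < s"
  shows "(\<integral>t. poly p t * (t ^ (e' - e) * cauchy 1 (monom 1 e * h) t) \<partial>N) = 0"
    "integrable N (\<lambda>t. poly p t * (t ^ (e' - e) * cauchy 1 (monom 1 e * h) t))"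
proof -
  let ?c = "cauchy 1 (monom 1 e * h)"
  have ae: "AE t in N. cauchy 1 (monom 1 (e' + j) * h) t = t ^ (j + (e' - e)) * ?c t" if "j < s" for j
    using suppN
  proof eventually_elim
    case (elim t)
    have "e + (j + (e' - e)) = e' + j" using assms by simp
    with cauchy_power[OF assms(1), of "j + (e' - e)" t] show ?case
      using assms that elim a_pos by (simp add: ac_simps)
  qed
  have [measurable]: "?c \<in> borel_measurable borel"
    using integrable_N_cauchy[of e h] by (auto dest: borel_measurable_integrable)
  have [measurable]: "cauchy 1 (monom 1 (e' + j) * h) \<in> borel_measurable borel" for j
    using integrable_N_cauchy[of "e' + j" h] by (auto dest: borel_measurable_integrable)
  have int: "integrable N (\<lambda>t. t ^ (j + (e' - e)) * ?c t)" if "j < s" for j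
  proof -
    from ae[OF that] have "integrable N (cauchy 1 (monom 1 (e' + j) * h)) = integrable N (\<lambda>t. t ^ (j + (e' - e)) * ?c t)"
      by (intro integrable_cong_AE) measurable
    with integrable_N_cauchy[of "e' + j" h] show ?thesis by simp
  qed
  have zero: "(\<integral>t. t ^ (j + (e' - e)) * ?c t \<partial>N) = 0" if "j < s" for j
  proof -
    from ae[OF that] have "(\<integral>t. cauchy 1 (monom 1 (e' + j) * h) t \<partial>N) = (\<integral>t. t ^ (j + (e' - e)) * ?c t \<partial>N)"
      by (intro integral_cong_AE) measurable
    moreover have "markov_moment h (e' + j) = 0" using that assms(1) by (auto simp: moment_orth_def)
    ultimately show ?thesis by (simp add: markov_moment_eq_cauchy)
  qed
  have eq: "(\<lambda>t. poly p t * (t ^ (e' - e) * ?c t)) = (\<lambda>t. \<Sum>j\<le>degree p. coeff p j * (t ^ (j + (e' - e)) * ?c t))"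
    by (auto simp: poly_altdef sum_distrib_left sum_distrib_right power_add mult_ac)
  show "integrable N (\<lambda>t. poly p t * (t ^ (e' - e) * ?c t))"
    unfolding eq using assms(4) int by (intro Bochner_Integration.integrable_sum integrable_mult_right) auto
  show "(\<integral>t. poly p t * (t ^ (e' - e) * ?c t) \<partial>N) = 0"
    unfolding eq using assms(4) int zero by (subst Bochner_Integration.integral_sum) auto
qed

text \<open>On the negative axis the transform is \<open>W\<close> times a continuous function
  without zeros, hence of constant sign. If \<open>V\<close> had degree below \<open>s\<close>, an
  integrand of constant sign would integrate to zero against N, forcing
  \<open>V * W = 0\<close>.\<close>

lemma degree_test_N:
  assumes "moment_orth e e' r s h" "e \<le> e'" "s + e' \<le> r + 1 + e"
    and W: "divides_cauchy r (monom 1 e * h) W" and nz: "\<And>z. z < 0 \<Longrightarrow> cauchy W (monom 1 e * h) z \<noteq> 0"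
    and V: "\<And>t. poly V t * poly W t \<ge> 0" "V \<noteq> 0"
  shows "s \<le> degree V"
proof (rule ccontr)
  assume "\<not> s \<le> degree V"
  then have dV: "degree V < s" by simp
  note orth = cauchy_orth[OF assms(1-3) dV]
  have nf: "nonneg_free W" using W by (simp add: divides_cauchy_def)
  let ?k = "cauchy W (monom 1 e * h)"
  have cont: "continuous_on {..<0} ?k"
    using nf by (intro continuous_at_imp_continuous_on ballI cauchy_isCont) auto
  \<comment> \<open>The constant signs of \<open>?k\<close> and of \<open>t ^ (e' - e)\<close> on
    the negative axis; -1 is just a sample point.\<close>
  define \<sigma> where "\<sigma> = sgn (?k (-1)) * (-1) ^ (e' - e)"
  have sg: "sgn (?k z) = sgn (?k (-1))" if "z < 0" for z
  proof (rule ccontr)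
    assume "sgn (?k z) \<noteq> sgn (?k (-1))"
    then have "?k z < 0 \<and> 0 < ?k (-1) \<or> ?k (-1) < 0 \<and> 0 < ?k z"
      using nz[OF that] nz[of "-1"] by (auto simp: sgn_if split: if_splits)
    moreover have "connected (?k ` {..<0})" using cont by (intro connected_continuous_image) auto
    ultimately have "0 \<in> ?k ` {..<0}"
      using that unfolding connected_iff_interval
      by (smt (verit) image_eqI lessThan_iff)
    then show False using nz by auto
  qed
  have rew: "poly V t * (t ^ (e' - e) * cauchy 1 (monom 1 e * h) t) * \<sigma>
      = (poly V t * poly W t) * \<bar>t\<bar> ^ (e' - e) * \<bar>?k t\<bar>" if "t < 0" for t
  proof -
    have "cauchy 1 (monom 1 e * h) t = poly W t * ?k t" using W that by (simp add: divides_cauchy_def)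
    moreover have "\<bar>?k t\<bar> = ?k t * sgn (?k (-1))" using sg[OF that] by (simp add: abs_sgn)
    moreover have "\<bar>t\<bar> ^ (e' - e) = t ^ (e' - e) * (-1) ^ (e' - e)" using that by (simp flip: power_mult_distrib)
    ultimately show ?thesis by (simp add: \<sigma>_def mult_ac)
  qed
  let ?g = "\<lambda>t. poly V t * (t ^ (e' - e) * cauchy 1 (monom 1 e * h) t) * \<sigma>"
  have "integrable N ?g" using orth by simp
  moreover have "(\<integral>t. ?g t \<partial>N) = 0" using orth by simp
  moreover have "AE t in N. ?g t \<ge> 0"
    using suppN
  proof eventually_elim
    case (elim t)
    then have "t < 0" using a_pos by auto
    then show ?case unfolding rew[OF \<open>t < 0\<close>] using V(1) by (intro mult_nonneg_nonneg[OF mult_nonneg_nonneg]) auto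
  qed
  ultimately have "AE t in N. ?g t = 0" using integral_nonneg_eq_0_iff_AE by blast
  then have "AE t in N. poly (V * W) t = 0"
    using suppN
  proof eventually_elim
    case (elim t)
    then have "t < 0" using a_pos by auto
    then show ?case using elim nz unfolding rew[OF \<open>t < 0\<close>] by auto
  qed
  then have "V * W = 0" by (rule poly_eq_0_AE_N)
  then show False using V(2) nf by (auto simp: nonneg_free_def)
qed

lemma poly_double_root:
  fixes p :: "real poly"
  assumes "poly p z = 0" "poly (pderiv p) z = 0"
  obtains g where "p = [:-z, 1:] * [:-z, 1:] * g"
proof -
  from assms(1) obtain q where q: "p = [:-z, 1:] * q" by (auto simp: poly_eq_0_iff_dvd)
  with assms(2) have "poly q z = 0" by (simp add: pderiv_mult pderiv_pCons del: mult_pCons_left)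
  then obtain g where "q = [:-z, 1:] * g" by (auto simp: poly_eq_0_iff_dvd)
  with q show ?thesis by (intro that[of g]) (simp only: mult.assoc)
qed

lemma moment_orth_maximal_divisor:
  assumes "moment_orth e e' r s h" "e \<le> e'" "s + e' \<le> r + 1 + e" "h \<noteq> 0"
  obtains W where "divides_cauchy r (monom 1 e * h) W" "s \<le> degree W"
    "\<And>z. z < 0 \<Longrightarrow> cauchy W (monom 1 e * h) z \<noteq> 0"
proof -
  have "(\<integral>x. poly (monom 1 e * h) x * x ^ j \<partial>M) = 0" if "j < r" for j
    using assms(1) that unfolding moment_orth_def moment_def
    by (auto simp: poly_monom power_add mult_ac dest!: spec[of _ "e + j"])
  from maximal_divisor[OF this assms(4)] obtain W where W: "divides_cauchy r (monom 1 e * h) W"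
    "\<And>z. z < 0 \<Longrightarrow> cauchy W (monom 1 e * h) z \<noteq> 0" by metis
  then have "W \<noteq> 0" by (auto simp: divides_cauchy_def nonneg_free_def)
  \<comment> \<open>Tested with \<open>V = W\<close>, where the product is a square.\<close>
  then have "s \<le> degree W" by (intro degree_test_N[OF assms(1-3) W]) auto
  with W show ?thesis by (intro that)
qed

text \<open>Normality: the \<open>s\<close> relations on N force \<open>W\<close> to have degree at
  least \<open>s\<close>, and every zero of \<open>W\<close> is worth one more relation on
  M.\<close>

theorem moment_orth_degree:
  assumes "moment_orth e e' r s h" "e \<le> e'" "s + e' \<le> r + 1 + e" "h \<noteq> 0"
  shows "r + s \<le> degree h"
  by (rule moment_orth_maximal_divisor[OF assms]) (use degree_bound[OF _ assms(4), of r e] in fastforce)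

text \<open>Removing a double factor lowers the degree by two, so even with one relation missing the
  quotient \<open>g\<close> has degree at most r + s - 1 and is an admissible test polynomial;
  \<open>h * g\<close> is a square.\<close>

theorem moment_orth_no_double_zero:
  assumes "moment_orth e e' r s h" "e \<le> e'" "s + e' \<le> r + 1 + e" "h \<noteq> 0" "degree h \<le> r + s + 1"
  shows "\<not> (poly h z = 0 \<and> poly (pderiv h) z = 0)"
proof
  assume "poly h z = 0 \<and> poly (pderiv h) z = 0"
  then obtain g where g: "h = [:-z, 1:] * [:-z, 1:] * g" using poly_double_root by metis
  then have g0: "g \<noteq> 0" using assms(4) by auto
  have dg: "degree h = degree g + 2" unfolding g using g0 by (simp add: degree_mult_eq del: mult_pCons_left mult_pCons_right)
  obtain W where W: "divides_cauchy r (monom 1 e * h) W" "s \<le> degree W"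
    and "\<And>z. z < 0 \<Longrightarrow> cauchy W (monom 1 e * h) z \<noteq> 0"
    by (fact moment_orth_maximal_divisor[OF assms(1-4)])
  have "poly h x * poly g x \<ge> 0" for x
  proof -
    have "poly h x * poly g x = ((x - z) * poly g x)\<^sup>2" by (simp add: g power2_eq_square algebra_simps)
    then show ?thesis by simp
  qed
  then have "h * g = 0" using W dg assms(5) by (intro test_eq_0[OF W(1)]) auto
  then show False using g0 assms(4) by simp
qed

text \<open>A double zero of the transform is a double zero of \<open>W\<close>, since the cofactor
  does not vanish. Without the double factor \<open>W\<close> still passes the test on N, so it has
  degree at least s + 2, whereas \<open>degree_bound\<close> allows only s + 1.\<close>

theorem moment_orth_cauchy_no_double_zero:
  assumes "moment_orth e e' r s h" "e \<le> e'" "s + e' \<le> r + 1 + e" "h \<noteq> 0" "degree h \<le> r + s + 1" "z < 0"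
  shows "\<not> (cauchy 1 (monom 1 e * h) z = 0 \<and> cauchy [:-z, 1:] (monom 1 e * h) z = 0)"
proof
  assume zero: "cauchy 1 (monom 1 e * h) z = 0 \<and> cauchy [:-z, 1:] (monom 1 e * h) z = 0"
  obtain W where W: "divides_cauchy r (monom 1 e * h) W" and "s \<le> degree W"
    and nz: "\<And>z. z < 0 \<Longrightarrow> cauchy W (monom 1 e * h) z \<noteq> 0"
    by (fact moment_orth_maximal_divisor[OF assms(1-4)])
  let ?H = "monom 1 e * h"
  have nf: "nonneg_free W" using W by (simp add: divides_cauchy_def)
  have fac: "\<And>y. y < 0 \<Longrightarrow> cauchy 1 ?H y = poly W y * cauchy W ?H y" using W by (simp add: divides_cauchy_def)
  have W0: "poly W z = 0" using fac[OF assms(6)] zero nz[OF assms(6)] by simp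
  have nf1: "nonneg_free 1" by (simp add: nonneg_free_def)
  have "(cauchy 1 ?H has_real_derivative 0) (at z)"
    using cauchy_deriv[OF nf1 assms(6), of ?H] zero by simp
  then have D0: "((\<lambda>y. poly W y * cauchy W ?H y) has_real_derivative 0) (at z)"
    using assms(6) fac
    by (subst DERIV_cong_ev[OF refl _ refl]) (auto intro!: eventually_mono[OF eventually_nhds_in_open[of "{..<0}" z]])
  have "((\<lambda>y. poly W y * cauchy W ?H y) has_real_derivative
      poly (pderiv W) z * cauchy W ?H z + cauchy (W * [:-z, 1:]) ?H z * poly W z) (at z)"
    by (intro DERIV_mult' DERIV_mult poly_DERIV cauchy_deriv nf assms)
  from DERIV_unique[OF this D0] have "poly (pderiv W) z = 0" using W0 nz[OF assms(6)] by simp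
  with W0 obtain V where V: "W = [:-z, 1:] * [:-z, 1:] * V" using poly_double_root by metis
  then have V0: "V \<noteq> 0" using nf by (auto simp: nonneg_free_def)
  have dV: "degree W = degree V + 2" unfolding V using V0 by (simp add: degree_mult_eq del: mult_pCons_left mult_pCons_right)
  have "poly V t * poly W t \<ge> 0" for t
  proof -
    have "poly V t * poly W t = ((t - z) * poly V t)\<^sup>2" by (simp add: V power2_eq_square algebra_simps)
    then show ?thesis by simp
  qed
  then have "s \<le> degree V" using V0 by (intro degree_test_N[OF assms(1-3) W nz])
  with degree_bound[OF W assms(4)] dV assms(5) show False by simp
qed

end

section \<open>Double zeros in pencils and interlacing\<close>

text \<open>Gaussian elimination, one unknown per equation. The index sets are arbitrary so that a
  sum type can index the ordinary and the Markov relations together.\<close>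

lemma homogeneous_system:
  fixes A :: "'i \<Rightarrow> 'j \<Rightarrow> 'a::field"
  assumes "finite I" "finite J" "card I < card J"
  shows "\<exists>x. (\<exists>j\<in>J. x j \<noteq> 0) \<and> (\<forall>i\<in>I. (\<Sum>j\<in>J. A i j * x j) = 0)"
  using assms
proof (induction I arbitrary: A J rule: finite_induct)
  case empty
  then obtain j where "j \<in> J" by fastforce
  then show ?case by (intro exI[of _ "\<lambda>_. 1"]) auto
next
  case (insert i I)
  show ?case
  proof (cases "\<forall>j\<in>J. A i j = 0")
    case True
    have "card I < card J" using insert.prems insert.hyps by simp
    from insert.IH[OF insert.prems(1) this, of A]
    obtain x where "\<exists>j\<in>J. x j \<noteq> 0" "\<forall>i'\<in>I. (\<Sum>j\<in>J. A i' j * x j) = 0" by blast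
    then show ?thesis using True by (intro exI[of _ x]) simp
  next
    case False
    then obtain k where k: "k \<in> J" "A i k \<noteq> 0" by auto
    define J' where "J' = J - {k}"
    have J: "J = insert k J'" "k \<notin> J'" "finite J'" using k insert.prems by (auto simp: J'_def)
    have "card I < card J'" using J insert.prems insert.hyps by simp
    from insert.IH[OF J(3) this, of "\<lambda>i' j. A i' j - A i' k * A i j / A i k"]
    obtain x where x: "\<exists>j\<in>J'. x j \<noteq> 0"
      "\<And>i'. i' \<in> I \<Longrightarrow> (\<Sum>j\<in>J'. (A i' j - A i' k * A i j / A i k) * x j) = 0" by blast
    define S where "S = (\<Sum>j\<in>J'. A i j * x j)"
    \<comment> \<open>Back substitution: equation \<open>i\<close> is solved for the pivot unknown
      \<open>k\<close>.\<close>
    define y where "y = x(k := - S / A i k)"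
    have y: "(\<Sum>j\<in>J. A i' j * y j) = (\<Sum>j\<in>J'. A i' j * x j) - A i' k * S / A i k" for i'
    proof -
      have "(\<Sum>j\<in>J'. A i' j * y j) = (\<Sum>j\<in>J'. A i' j * x j)"
        using J(2) by (intro sum.cong) (auto simp: y_def)
      then show ?thesis unfolding J(1) using J by (simp add: y_def)
    qed
    have "(\<Sum>j\<in>J. A i' j * y j) = 0" if "i' \<in> I" for i'
      using x(2)[OF that] unfolding y S_def
      by (simp add: algebra_simps sum_subtractf sum_distrib_left sum_divide_distrib)
    moreover have "(\<Sum>j\<in>J. A i j * y j) = 0" unfolding y using k by (simp add: S_def)
    moreover have "\<exists>j\<in>J. y j \<noteq> 0" using x(1) J by (auto simp: y_def)
    ultimately show ?thesis by auto
  qed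
qed

text \<open>If no pencil member \<open>A f + B g\<close> has a double zero, Rolle's theorem for the quotients
  \<open>f / g\<close> and \<open>g / f\<close> forces the zeros of \<open>f\<close> and \<open>g\<close> to interlace.\<close>

lemma no_double_zero_quotient:
  fixes f g f' g' :: "real \<Rightarrow> real"
  assumes "x < y" "f x = 0" "f y = 0" and nz: "\<And>z. x \<le> z \<Longrightarrow> z \<le> y \<Longrightarrow> g z \<noteq> 0"
    and D: "\<And>z. x \<le> z \<Longrightarrow> z \<le> y \<Longrightarrow> (f has_real_derivative f' z) (at z)"
      "\<And>z. x \<le> z \<Longrightarrow> z \<le> y \<Longrightarrow> (g has_real_derivative g' z) (at z)"
    and nd: "\<And>A B z. x \<le> z \<Longrightarrow> z \<le> y \<Longrightarrow> A \<noteq> 0 \<or> B \<noteq> 0 \<Longrightarrow> A * f z + B * g z = 0 \<Longrightarrow> A * f' z + B * g' z = 0 \<Longrightarrow> False"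
  shows False
proof -
  have D': "((\<lambda>z. f z / g z) has_real_derivative (f' z * g z - f z * g' z) / (g z * g z)) (at z)"
    if "x \<le> z" "z \<le> y" for z
    using that by (intro DERIV_divide D nz)
  have "\<exists>z. x < z \<and> z < y \<and> ((\<lambda>z. f z / g z) has_real_derivative 0) (at z)"
  proof (rule Rolle[OF assms(1)])
    show "continuous_on {x..y} (\<lambda>z. f z / g z)"
      by (intro continuous_at_imp_continuous_on ballI) (auto intro: DERIV_isCont[OF D'])
    show "(\<lambda>z. f z / g z) differentiable at z" if "x < z" "z < y" for z
      using D'[of z] that real_differentiable_def by (meson less_imp_le)
  qed (use assms in auto)
  then obtain z where z: "x < z" "z < y" "((\<lambda>z. f z / g z) has_real_derivative 0) (at z)" by auto
  have "(f' z * g z - f z * g' z) / (g z * g z) = 0" using DERIV_unique[OF D'[of z] z(3)] z by simp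
  then have "g z * f' z + (- f z) * g' z = 0" using nz[of z] z by (auto simp: algebra_simps)
  then show False using nd[of z "g z" "- f z"] nz[of z] z by (auto simp: algebra_simps)
qed

text \<open>Existence and uniqueness are one argument with \<open>f\<close> and \<open>g\<close>
  exchanged: neither function can have two zeros with no zero of the other on the closed interval
  between them. The complex functions \<open>u\<close> and \<open>v\<close> enter through their
  zeros only, because the original functions carry additional nonvanishing factors.\<close>

lemma interlacing:
  fixes f g f' g' :: "real \<Rightarrow> real" and u v :: "real \<Rightarrow> complex"
  assumes I: "\<And>x y z. x \<in> I \<Longrightarrow> y \<in> I \<Longrightarrow> x \<le> z \<Longrightarrow> z \<le> y \<Longrightarrow> z \<in> I"
    and D: "\<And>z. z \<in> I \<Longrightarrow> (f has_real_derivative f' z) (at z)"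
      "\<And>z. z \<in> I \<Longrightarrow> (g has_real_derivative g' z) (at z)"
    and nd: "\<And>A B z. z \<in> I \<Longrightarrow> A \<noteq> 0 \<or> B \<noteq> 0 \<Longrightarrow> A * f z + B * g z = 0 \<Longrightarrow> A * f' z + B * g' z = 0 \<Longrightarrow> False"
    and uv: "\<And>x. x \<in> I \<Longrightarrow> u x = 0 \<longleftrightarrow> f x = 0" "\<And>x. x \<in> I \<Longrightarrow> v x = 0 \<longleftrightarrow> g x = 0"
    and cz: "consec_zeros u I x y"
  shows "\<exists>!z. x < z \<and> z < y \<and> v z = 0"
proof -
  from cz have xy: "x < y" "x \<in> I" "y \<in> I" by (auto simp: consec_zeros_def)
  have inI: "z \<in> I" if "x \<le> z" "z \<le> y" for z using I xy that by blast
  have f: "f x = 0" "f y = 0" "\<And>z. x < z \<Longrightarrow> z < y \<Longrightarrow> f z \<noteq> 0"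
    using cz uv inI by (auto simp: consec_zeros_def)
  have nc: "g z \<noteq> 0" if "f z = 0" "z \<in> I" for z
  proof
    assume g0: "g z = 0"
    show False
    \<comment> \<open>At a common zero all pencil members vanish, and some nontrivial member also
      has derivative zero: \<open>f\<close> itself, or the one with coefficients
      \<open>- g' z\<close> and \<open>f' z\<close>.\<close>
    proof (cases "f' z = 0")
      case True
      with nd[OF that(2), of 1 0] that show False by auto
    next
      case False
      with nd[OF that(2), of "- g' z" "f' z"] that g0 show False by auto
    qed
  qed
  have "\<exists>z. x < z \<and> z < y \<and> g z = 0"
  proof (rule ccontr)
    assume "\<not> ?thesis"
    then have "g z \<noteq> 0" if "x \<le> z" "z \<le> y" for z
      using that nc f xy by (cases "z = x \<or> z = y") (auto simp: less_le)
    then show False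
      by (rule no_double_zero_quotient[OF xy(1) f(1,2), of g f' g']) (use inI D nd in blast)+
  qed
  moreover have False if "x < s" "s < t" "t < y" "g s = 0" "g t = 0" for s t
  proof (rule no_double_zero_quotient[of s t g f g' f'])
    show "f z \<noteq> 0" if "s \<le> z" "z \<le> t" for z using f(3)[of z] that \<open>x < s\<close> \<open>t < y\<close> by auto
    show "False" if "s \<le> z" "z \<le> t" "A \<noteq> 0 \<or> B \<noteq> 0" "A * g z + B * f z = 0" "A * g' z + B * f' z = 0" for A B z
      using nd[of z B A] inI[of z] that \<open>x < s\<close> \<open>t < y\<close> by (auto simp: add.commute)
  qed (use that inI D in auto)
  ultimately have "\<exists>!z. x < z \<and> z < y \<and> g z = 0" by (metis linorder_less_linear)
  then show ?thesis using uv(2) inI by (metis less_imp_le)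
qed

section \<open>Arithmetic of the numbers of relations\<close>

lemma less_div_3: "m < k div 3 \<Longrightarrow> 3 * m + 3 \<le> k" for m k :: nat
  by linarith

text \<open>The counts mix division by 2, from the two families of relations, with division by 3,
  from the symmetry; in each class mod 6 they are linear in \<open>i\<close>.\<close>

lemma mod_6_cases:
  "\<exists>i. n = 6 * i \<and> n div 2 = 3 * i \<and> (n + 1) div 2 = 3 * i \<and> (n + 2) div 2 = 3 * i + 1 \<and> n div 3 = 2 * i \<and> n mod 3 = 0 \<or>
     n = 6 * i + 1 \<and> n div 2 = 3 * i \<and> (n + 1) div 2 = 3 * i + 1 \<and> (n + 2) div 2 = 3 * i + 1 \<and> n div 3 = 2 * i \<and> n mod 3 = 1 \<or>
     n = 6 * i + 2 \<and> n div 2 = 3 * i + 1 \<and> (n + 1) div 2 = 3 * i + 1 \<and> (n + 2) div 2 = 3 * i + 2 \<and> n div 3 = 2 * i \<and> n mod 3 = 2 \<or>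
     n = 6 * i + 3 \<and> n div 2 = 3 * i + 1 \<and> (n + 1) div 2 = 3 * i + 2 \<and> (n + 2) div 2 = 3 * i + 2 \<and> n div 3 = 2 * i + 1 \<and> n mod 3 = 0 \<or>
     n = 6 * i + 4 \<and> n div 2 = 3 * i + 2 \<and> (n + 1) div 2 = 3 * i + 2 \<and> (n + 2) div 2 = 3 * i + 3 \<and> n div 3 = 2 * i + 1 \<and> n mod 3 = 1 \<or>
     n = 6 * i + 5 \<and> n div 2 = 3 * i + 2 \<and> (n + 1) div 2 = 3 * i + 3 \<and> (n + 2) div 2 = 3 * i + 3 \<and> n div 3 = 2 * i + 1 \<and> n mod 3 = 2"
  for n :: nat
proof -
  have "\<exists>i. n = 6 * i \<or> n = 6 * i + 1 \<or> n = 6 * i + 2 \<or> n = 6 * i + 3 \<or> n = 6 * i + 4 \<or> n = 6 * i + 5" by presburger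
  then obtain i where "n = 6 * i \<or> n = 6 * i + 1 \<or> n = 6 * i + 2 \<or> n = 6 * i + 3 \<or> n = 6 * i + 4 \<or> n = 6 * i + 5" ..
  then show ?thesis by (intro exI[of _ i]) (elim disjE; simp; presburger)
qed

text \<open>Needed for every residue class \<open>l\<close>, not only that of n: a nonzero section
  of degree \<open>d\<close> puts a nonzero coefficient at index \<open>3 * d + l\<close>, and
  normality pushes this index up to at least n.\<close>

lemma relation_count:
  fixes n :: nat
  assumes "((n + 1) div 2 + l + 2) div 3 - (l + 2) div 3 + ((n div 2 + l + 4) div 3 - (l + 4) div 3) \<le> d"
    and "l = 0 \<or> l = 1 \<or> l = 2"
  shows "n \<le> 3 * d + l"
  using assms(2,1) mod_6_cases[of n] by (elim exE disjE conjE; simp)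

lemma relation_count_mod:
  "((n + 1) div 2 + n mod 3 + 2) div 3 - (n mod 3 + 2) div 3 + ((n div 2 + n mod 3 + 4) div 3 - (n mod 3 + 4) div 3) = n div 3"
  for n :: nat
  using mod_6_cases[of n] by (elim exE disjE conjE; simp)

text \<open>For n mod 3 = 2: if \<open>x * q\<close> coincided with the next polynomial,
  \<open>q\<close> would satisfy more relations than its degree n div 3 allows. The companion
  inequality says that \<open>x * q\<close>, of degree one higher, misses at most one
  relation.\<close>

lemma relation_count_2:
  fixes n :: nat
  assumes "n mod 3 = 2"
  shows "n div 3 < ((n + 2) div 2 + 5) div 3 - 1 + (((n + 1) div 2 + 7) div 3 - 2)"
  using assms mod_6_cases[of n] by (elim exE disjE conjE; simp)
lemma relation_count_2':
  fixes n :: nat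
  assumes "n mod 3 = 2"
  shows "Suc (n div 3) \<le> ((n + 1) div 2 + 1) div 3 + ((n div 2 + 3) div 3 - 1) + 1"
  using assms mod_6_cases[of n] by (elim exE disjE conjE; simp)

section \<open>Existence of the reduced polynomials and pencils of consecutive ones\<close>

context nikishin_pair
begin

lemma integrable_moment: "integrable M (\<lambda>x. poly h x * x ^ m)"
  by (intro integrable_continuous_M) (auto intro!: continuous_intros)

lemma integrable_markov_moment: "integrable M (\<lambda>x. poly h x * x ^ m * markov x)"
  using integrable_markov[of "h * monom 1 m"] by (simp add: poly_monom)

lemma moment_add: "moment (p + q) m = moment p m + moment q m"
  unfolding moment_def by (simp add: distrib_right integrable_moment)

lemma markov_moment_add: "markov_moment (p + q) m = markov_moment p m + markov_moment q m"
  unfolding markov_moment_def by (simp add: distrib_right integrable_markov_moment)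

lemma moment_smult: "moment (smult k p) m = k * moment p m"
  unfolding moment_def poly_smult mult.assoc by (simp only: integral_mult_right_zero)

lemma markov_moment_smult: "markov_moment (smult k p) m = k * markov_moment p m"
  unfolding markov_moment_def poly_smult mult.assoc by (simp only: integral_mult_right_zero)

lemma moment_0: "moment 0 m = 0" and markov_moment_0: "markov_moment 0 m = 0"
  by (simp_all add: moment_def markov_moment_def)

lemma moment_sum: "moment (\<Sum>j\<in>J. P j) m = (\<Sum>j\<in>J. moment (P j) m)"
  by (induction J rule: infinite_finite_induct) (auto simp: moment_0 moment_add)

lemma markov_moment_sum: "markov_moment (\<Sum>j\<in>J. P j) m = (\<Sum>j\<in>J. markov_moment (P j) m)"
  by (induction J rule: infinite_finite_induct) (auto simp: markov_moment_0 markov_moment_add)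

lemma moment_shift: "moment (monom 1 1 * p) m = moment p (Suc m)"
  unfolding moment_def by (simp add: poly_monom mult_ac)

lemma markov_moment_shift: "markov_moment (monom 1 1 * p) m = markov_moment p (Suc m)"
  unfolding markov_moment_def by (simp add: poly_monom mult_ac)

lemma moment_orth_add: "moment_orth e e' r s p \<Longrightarrow> moment_orth e e' r s q \<Longrightarrow> moment_orth e e' r s (smult A p + smult B q)"
  by (simp add: moment_orth_def moment_add markov_moment_add moment_smult markov_moment_smult)

text \<open>There are r + s linear equations for r + s + 1 coefficients.\<close>

lemma exists_moment_orth:
  obtains h where "moment_orth e e' r s h" "h \<noteq> 0" "degree h \<le> r + s"
proof -
  define I where "I = {e..<e + r} <+> {e'..<e' + s}"
  define A where "A = (\<lambda>i j. case i of Inl m \<Rightarrow> moment (monom 1 j) m | Inr m \<Rightarrow> markov_moment (monom 1 j) m)"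
  have "card I < card {..r + s}" by (simp add: I_def card_Plus)
  moreover have "finite I" by (simp add: I_def)
  ultimately obtain x where x: "\<exists>j\<le>r + s. x j \<noteq> 0" "\<And>i. i \<in> I \<Longrightarrow> (\<Sum>j\<le>r + s. A i j * x j) = 0"
    using homogeneous_system[of I "{..r + s}" A] by auto
  define h where "h = (\<Sum>j\<le>r + s. smult (x j) (monom 1 j))"
  have c: "coeff h j = (if j \<le> r + s then x j else 0)" for j
    unfolding h_def by (simp add: coeff_sum if_distrib[of "\<lambda>y. _ * y"] cong: if_cong)
  have "h \<noteq> 0" using x(1) c by (metis coeff_0)
  moreover have "degree h \<le> r + s" using c by (intro degree_le) auto
  moreover have "moment_orth e e' r s h"
    unfolding moment_orth_def h_def moment_sum markov_moment_sum moment_smult markov_moment_smult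
  proof (intro conjI allI impI)
    show "(\<Sum>j\<le>r + s. x j * moment (monom 1 j) m) = 0" if "e \<le> m \<and> m < e + r" for m
      using x(2)[of "Inl m"] that by (simp add: I_def A_def InlI mult.commute)
    show "(\<Sum>j\<le>r + s. x j * markov_moment (monom 1 j) m) = 0" if "e' \<le> m \<and> m < e' + s" for m
      using x(2)[of "Inr m"] that by (simp add: I_def A_def InrI mult.commute)
  qed
  ultimately show ?thesis by (intro that)
qed

text \<open>The orthogonality relations of \<open>z ^ l * h (z ^ 3)\<close> in terms of \<open>h\<close>.\<close>

definition star_orth :: "nat \<Rightarrow> nat \<Rightarrow> real poly \<Rightarrow> bool" where
  "star_orth l n h \<longleftrightarrow> (\<forall>m. l \<le> 3 * m \<and> 3 * m < (n + 1) div 2 + l \<longrightarrow> moment h m = 0) \<and>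
     (\<forall>m. l + 2 \<le> 3 * m \<and> 3 * m < n div 2 + l + 2 \<longrightarrow> markov_moment h m = 0)"

text \<open>\<open>(l + 2) div 3\<close> and \<open>(l + 4) div 3\<close> are l / 3 and (l + 2) / 3
  rounded up. The upper limits are rounded up in the same way, and the differences are the lengths
  of the two windows of exponents.\<close>

lemma star_orth_iff_moment_orth:
  "star_orth l n h \<longleftrightarrow> moment_orth ((l + 2) div 3) ((l + 4) div 3)
     (((n + 1) div 2 + l + 2) div 3 - (l + 2) div 3) ((n div 2 + l + 4) div 3 - (l + 4) div 3) h"
proof -
  have "l \<le> 3 * m \<and> 3 * m < (n + 1) div 2 + l \<longleftrightarrow>
      (l + 2) div 3 \<le> m \<and> m < (l + 2) div 3 + (((n + 1) div 2 + l + 2) div 3 - (l + 2) div 3)" for m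
    by linarith
  moreover have "l + 2 \<le> 3 * m \<and> 3 * m < n div 2 + l + 2 \<longleftrightarrow>
      (l + 4) div 3 \<le> m \<and> m < (l + 4) div 3 + ((n div 2 + l + 4) div 3 - (l + 4) div 3)" for m
    by linarith
  ultimately show ?thesis unfolding star_orth_def moment_orth_def by simp
qed

lemma star_orth_zero:
  assumes "star_orth l n h" "l < 3" "3 * degree h + l < n"
  shows "h = 0"
proof (rule ccontr)
  assume "h \<noteq> 0"
  have "((n + 1) div 2 + l + 2) div 3 - (l + 2) div 3 + ((n div 2 + l + 4) div 3 - (l + 4) div 3) \<le> degree h"
    by (rule moment_orth_degree[OF assms(1)[unfolded star_orth_iff_moment_orth] _ _ \<open>h \<noteq> 0\<close>]) linarith+
  moreover have "l = 0 \<or> l = 1 \<or> l = 2" using assms by auto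
  ultimately show False using relation_count[of n l "degree h"] assms(3) by linarith
qed

lemma exists_star_orth:
  obtains h where "star_orth (n mod 3) n h" "lead_coeff h = 1" "degree h = n div 3"
proof -
  define l where "l = n mod 3"
  define r where "r = ((n + 1) div 2 + l + 2) div 3 - (l + 2) div 3"
  define s where "s = (n div 2 + l + 4) div 3 - (l + 4) div 3"
  have rs: "r + s = n div 3" unfolding r_def s_def l_def by (rule relation_count_mod)
  obtain h where h: "moment_orth ((l + 2) div 3) ((l + 4) div 3) r s h" "h \<noteq> 0" "degree h \<le> r + s"
    using exists_moment_orth by blast
  have side: "(l + 2) div 3 \<le> (l + 4) div 3" "s + (l + 4) div 3 \<le> r + 1 + (l + 2) div 3"
    unfolding r_def s_def by linarith+
  from moment_orth_degree[OF h(1) side h(2)] h(3) rs have deg: "degree h = n div 3" by simp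
  have "star_orth l n h" using h(1) unfolding star_orth_iff_moment_orth r_def s_def .
  then have "star_orth l n (smult (1 / lead_coeff h) h)" by (simp add: star_orth_def moment_smult markov_moment_smult)
  moreover have "lead_coeff h \<noteq> 0" using h(2) by simp
  ultimately show ?thesis using deg by (intro that[of "smult (1 / lead_coeff h) h"]) (simp_all add: l_def)
qed

text \<open>\<open>cauchy [:-z, 1:]\<close> is the derivative of \<open>cauchy 1\<close> at z, so
  the second half forbids double zeros of the transforms just as the first does for the polynomials.
  The exponent \<open>e\<close> is the common offset of the two transforms.\<close>

definition no_double_zeros :: "nat \<Rightarrow> real poly \<Rightarrow> real poly \<Rightarrow> bool" where
  "no_double_zeros e p q \<longleftrightarrow> (\<forall>A B. A \<noteq> 0 \<or> B \<noteq> 0 \<longrightarrow>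
     (\<forall>z. \<not> (A * poly p z + B * poly q z = 0 \<and> A * poly (pderiv p) z + B * poly (pderiv q) z = 0)) \<and>
     (\<forall>z<0. \<not> (A * cauchy 1 (monom 1 e * p) z + B * cauchy 1 (monom 1 e * q) z = 0 \<and>
        A * cauchy [:-z, 1:] (monom 1 e * p) z + B * cauchy [:-z, 1:] (monom 1 e * q) z = 0)))"

lemma cauchy_linear:
  assumes "nonneg_free W" "z < 0"
  shows "cauchy W (monom 1 e * (smult A p + smult B q)) z = A * cauchy W (monom 1 e * p) z + B * cauchy W (monom 1 e * q) z"
proof -
  have "cauchy W (monom 1 e * (smult A p + smult B q)) z =
     (\<integral>x. A * (poly (monom 1 e * p) x / (poly W x * (x - z))) + B * (poly (monom 1 e * q) x / (poly W x * (x - z))) \<partial>M)"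
    unfolding cauchy_def by (simp add: algebra_simps add_divide_distrib)
  also have "\<dots> = (\<integral>x. A * (poly (monom 1 e * p) x / (poly W x * (x - z))) \<partial>M) +
      (\<integral>x. B * (poly (monom 1 e * q) x / (poly W x * (x - z))) \<partial>M)"
    using assms by (intro Bochner_Integration.integral_add integrable_mult_right integrable_cauchy)
  finally show ?thesis unfolding cauchy_def integral_mult_right_zero .
qed

text \<open>With both members monic of one degree, a vanishing combination has
  \<open>B = - A\<close> and hence \<open>p = q\<close>. So every nontrivial combination is nonzero,
  and its degree exceeds the number of relations by at most one, as the theorems on double zeros
  require.\<close>

lemma pencil:
  assumes "moment_orth e e' r s p" "moment_orth e e' r s q" "e \<le> e'" "s + e' \<le> r + 1 + e"
    and "degree p = degree q" "degree p \<le> r + s + 1" "lead_coeff p = 1" "lead_coeff q = 1" "p \<noteq> q"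
  shows "no_double_zeros e p q"
  unfolding no_double_zeros_def
proof (intro allI impI conjI)
  fix A B :: real assume AB: "A \<noteq> 0 \<or> B \<noteq> 0"
  define h where "h = smult A p + smult B q"
  have "h \<noteq> 0"
  proof
    assume h0: "h = 0"
    then have "coeff h (degree p) = 0" by simp
    then have B: "B = - A" using assms(5,7,8) by (simp add: h_def)
    then have "smult A (p - q) = 0" using h0 by (simp add: h_def smult_diff_right)
    then show False using AB B assms(9) by auto
  qed
  moreover have "moment_orth e e' r s h" unfolding h_def using assms(1,2) by (rule moment_orth_add)
  moreover have "degree h \<le> r + s + 1"
    unfolding h_def using assms(5,6) by (intro degree_add_le) (auto intro: order_trans[OF degree_smult_le])
  ultimately have nd: "\<not> (poly h z = 0 \<and> poly (pderiv h) z = 0)"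
     "z < 0 \<Longrightarrow> \<not> (cauchy 1 (monom 1 e * h) z = 0 \<and> cauchy [:-z, 1:] (monom 1 e * h) z = 0)" for z
    using moment_orth_no_double_zero[of e e' r s h z] moment_orth_cauchy_no_double_zero[of e e' r s h z] assms(3,4) by auto
  show "\<not> (A * poly p z + B * poly q z = 0 \<and> A * poly (pderiv p) z + B * poly (pderiv q) z = 0)" for z
    using nd(1)[of z] by (simp add: h_def pderiv_add pderiv_smult)
  show "\<not> (A * cauchy 1 (monom 1 e * p) z + B * cauchy 1 (monom 1 e * q) z = 0 \<and>
        A * cauchy [:-z, 1:] (monom 1 e * p) z + B * cauchy [:-z, 1:] (monom 1 e * q) z = 0)" if "z < 0" for z
  proof -
    have "nonneg_free 1" "nonneg_free [:-z, 1:]" using that by (auto simp: nonneg_free_def)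
    with nd(2)[OF that] that show ?thesis by (simp add: h_def cauchy_linear)
  qed
qed

text \<open>A negative zero would yield an orthogonality relation for the constant 1, against
  \<open>degree_bound\<close>. This settles the small indices, whose reduced polynomials are
  constant.\<close>

lemma cauchy_one_nonzero:
  assumes "z < 0" shows "cauchy 1 (monom 1 e) z \<noteq> 0"
proof
  assume "cauchy 1 (monom 1 e) z = 0"
  then have "divides_cauchy 0 (monom 1 e * 1) (1 * [:-z, 1:])"
    using assms by (intro divides_cauchy_step divides_cauchy_1) auto
  from degree_bound[OF this] show False by simp
qed

text \<open>For \<open>n mod 3 = 2\<close> the first polynomial is multiplied by \<open>x\<close>, so that in every case both members
  of the pencil satisfy the same \<open>degree - 1\<close> orthogonality relations.\<close>

lemma adjacent_pencil:
  assumes q: "star_orth (n mod 3) n q" "lead_coeff q = 1" "degree q = n div 3"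
    and q': "star_orth (Suc n mod 3) (Suc n) q'" "lead_coeff q' = 1" "degree q' = Suc n div 3" and n: "2 \<le> n"
  obtains e p where "no_double_zeros e p q'" "\<And>x. x > 0 \<Longrightarrow> poly q x = 0 \<longleftrightarrow> poly p x = 0"
    "\<And>z. z < 0 \<Longrightarrow> cauchy 1 (monom 1 ((n mod 3 + 2) div 3) * q) z = 0 \<longleftrightarrow> cauchy 1 (monom 1 e * p) z = 0"
    "\<And>z. z < 0 \<Longrightarrow> cauchy 1 (monom 1 ((Suc n mod 3 + 2) div 3) * q') z = 0 \<longleftrightarrow> cauchy 1 (monom 1 e * q') z = 0"
proof -
  have "q \<noteq> 0" using q(2) by auto
  \<comment> \<open>The offsets are (0, 1), (1, 1) and (1, 2) for the residues 0, 1 and 2. Residues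
    0 and 1 share relations from (1, 1) on, residues 1 and 2 from (1, 2) on; after residue 2 the
    factor x shifts (1, 2) to (0, 1), the offsets of the next polynomial.\<close>
  consider "n mod 3 = 0" | "n mod 3 = 1" | "n mod 3 = 2" by linarith
  then show ?thesis
  proof cases
    case 1
    then have l: "Suc n mod 3 = 1" by presburger
    have o: "\<And>m. 3 * m < (n + 1) div 2 \<Longrightarrow> moment q m = 0" "\<And>m. 1 \<le> m \<Longrightarrow> 3 * m < n div 2 + 2 \<Longrightarrow> markov_moment q m = 0"
      "\<And>m. 1 \<le> m \<Longrightarrow> 3 * m < (n + 2) div 2 + 1 \<Longrightarrow> moment q' m = 0"
      "\<And>m. 1 \<le> m \<Longrightarrow> 3 * m < (n + 1) div 2 + 3 \<Longrightarrow> markov_moment q' m = 0"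
      using q(1) q'(1) unfolding star_orth_def 1 l by auto
    \<comment> \<open>If the two coincided, the polynomial would satisfy the relations of both, more
      than its degree permits. The other two cases argue alike.\<close>
    have neq: "q \<noteq> q'"
    proof
      assume eq: "q = q'"
      have "moment_orth 0 1 (((n + 2) div 2 + 3) div 3) (((n + 1) div 2 + 5) div 3 - 1) q"
        unfolding moment_orth_def
      proof (intro conjI allI impI)
        show "moment q m = 0" if "0 \<le> m \<and> m < 0 + ((n + 2) div 2 + 3) div 3" for m
          using o(1)[of m] o(3)[of m] that n unfolding eq by (cases "m = 0") auto
        show "markov_moment q m = 0" if "1 \<le> m \<and> m < 1 + (((n + 1) div 2 + 5) div 3 - 1)" for m
          using o(4)[of m] that unfolding eq by auto
      qed
      from moment_orth_degree[OF this] \<open>q \<noteq> 0\<close> have "((n + 2) div 2 + 3) div 3 + (((n + 1) div 2 + 5) div 3 - 1) \<le> degree q"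
        by auto
      then show False using q(3) 1 by linarith
    qed
    have cd: "moment_orth 1 1 (((n + 1) div 2 + 2) div 3 - 1) ((n div 2 + 4) div 3 - 1) q"
      "moment_orth 1 1 (((n + 1) div 2 + 2) div 3 - 1) ((n div 2 + 4) div 3 - 1) q'"
      unfolding moment_orth_def using o by auto
    have dg: "degree q = degree q'" using q(3) q'(3) 1 by presburger
    have db: "degree q \<le> ((n + 1) div 2 + 2) div 3 - 1 + ((n div 2 + 4) div 3 - 1) + 1"
      using q(3) 1 n by linarith
    have sd: "(n div 2 + 4) div 3 - 1 + 1 \<le> ((n + 1) div 2 + 2) div 3 - 1 + 1 + 1" by linarith
    have nd: "no_double_zeros 1 q q'" by (rule pencil[OF cd _ sd dg db q(2) q'(2) neq]) simp
    \<comment> \<open>The transform of \<open>q\<close> has offset 0, the pencil offset 1. Thanks to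
      this moment the change of offset is multiplication by z and keeps the negative zeros.\<close>
    have "moment q 0 = 0" using o(1)[of 0] n by simp
    then have cz: "cauchy 1 (monom 1 ((n mod 3 + 2) div 3) * q) z = 0 \<longleftrightarrow> cauchy 1 (monom 1 1 * q) z = 0" if "z < 0" for z
      using cauchy_monom_Suc[OF that, of 0 q] that 1 by simp
    show ?thesis by (rule that[OF nd _ cz]) (simp_all add: l)
  next
    case 2
    then have l: "Suc n mod 3 = 2" by presburger
    have o: "\<And>m. 1 \<le> m \<Longrightarrow> 3 * m < (n + 1) div 2 + 1 \<Longrightarrow> moment q m = 0" "\<And>m. 1 \<le> m \<Longrightarrow> 3 * m < n div 2 + 3 \<Longrightarrow> markov_moment q m = 0"
      "\<And>m. 1 \<le> m \<Longrightarrow> 3 * m < (n + 2) div 2 + 2 \<Longrightarrow> moment q' m = 0"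
      "\<And>m. 2 \<le> m \<Longrightarrow> 3 * m < (n + 1) div 2 + 4 \<Longrightarrow> markov_moment q' m = 0"
      using q(1) q'(1) unfolding star_orth_def 2 l by auto
    have neq: "q \<noteq> q'"
    proof
      assume eq: "q = q'"
      have "moment_orth 1 1 (((n + 2) div 2 + 4) div 3 - 1) (((n + 1) div 2 + 6) div 3 - 1) q"
        unfolding moment_orth_def
      proof (intro conjI allI impI)
        show "moment q m = 0" if "1 \<le> m \<and> m < 1 + (((n + 2) div 2 + 4) div 3 - 1)" for m
          using o(3)[of m] that unfolding eq by auto
        show "markov_moment q m = 0" if "1 \<le> m \<and> m < 1 + (((n + 1) div 2 + 6) div 3 - 1)" for m
          using o(2)[of m] o(4)[of m] that n unfolding eq by (cases "m = 1") auto
      qed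
      from moment_orth_degree[OF this] \<open>q \<noteq> 0\<close>
      have "((n + 2) div 2 + 4) div 3 - 1 + (((n + 1) div 2 + 6) div 3 - 1) \<le> degree q" by auto
      then show False using q(3) 2 n by linarith
    qed
    have cd: "moment_orth 1 2 (((n + 1) div 2 + 3) div 3 - 1) ((n div 2 + 5) div 3 - 2) q"
      "moment_orth 1 2 (((n + 1) div 2 + 3) div 3 - 1) ((n div 2 + 5) div 3 - 2) q'"
      unfolding moment_orth_def using o by auto
    have dg: "degree q = degree q'" using q(3) q'(3) 2 by presburger
    have db: "degree q \<le> ((n + 1) div 2 + 3) div 3 - 1 + ((n div 2 + 5) div 3 - 2) + 1"
      using q(3) 2 n by linarith
    have sd: "(n div 2 + 5) div 3 - 2 + 2 \<le> ((n + 1) div 2 + 3) div 3 - 1 + 1 + 1" using n by linarith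
    have nd: "no_double_zeros 1 q q'" by (rule pencil[OF cd _ sd dg db q(2) q'(2) neq]) simp
    show ?thesis by (rule that[OF nd]) (simp_all add: 2 l)
  next
    case 3
    then have l: "Suc n mod 3 = 0" by presburger
    define p where "p = monom 1 1 * q"
    have o: "\<And>m. 1 \<le> m \<Longrightarrow> 3 * m < (n + 1) div 2 + 2 \<Longrightarrow> moment q m = 0" "\<And>m. 2 \<le> m \<Longrightarrow> 3 * m < n div 2 + 4 \<Longrightarrow> markov_moment q m = 0"
      "\<And>m. 3 * m < (n + 2) div 2 \<Longrightarrow> moment q' m = 0"
      "\<And>m. 1 \<le> m \<Longrightarrow> 3 * m < (n + 1) div 2 + 2 \<Longrightarrow> markov_moment q' m = 0"
      using q(1) q'(1) unfolding star_orth_def 3 l by auto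
    have neq: "p \<noteq> q'"
    proof
      assume eq: "p = q'"
      have "moment_orth 1 2 (((n + 2) div 2 + 5) div 3 - 1) (((n + 1) div 2 + 7) div 3 - 2) q"
        unfolding moment_orth_def
      proof (intro conjI allI impI)
        show "moment q m = 0" if "1 \<le> m \<and> m < 1 + (((n + 2) div 2 + 5) div 3 - 1)" for m
          using o(3)[of "m - 1"] that unfolding eq[symmetric] p_def moment_shift by auto
        show "markov_moment q m = 0" if "2 \<le> m \<and> m < 2 + (((n + 1) div 2 + 7) div 3 - 2)" for m
          using o(4)[of "m - 1"] that unfolding eq[symmetric] p_def markov_moment_shift by auto
      qed
      from moment_orth_degree[OF this] \<open>q \<noteq> 0\<close>
      have "((n + 2) div 2 + 5) div 3 - 1 + (((n + 1) div 2 + 7) div 3 - 2) \<le> degree q" by auto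
      then show False using relation_count_2[OF 3] unfolding q(3) by (meson leD)
    qed
    have cp: "moment_orth 0 1 (((n + 1) div 2 + 1) div 3) ((n div 2 + 3) div 3 - 1) p"
      unfolding moment_orth_def p_def moment_shift markov_moment_shift
    proof (intro conjI allI impI)
      show "moment q (Suc m) = 0" if "0 \<le> m \<and> m < 0 + ((n + 1) div 2 + 1) div 3" for m
        using that less_div_3[of m "(n + 1) div 2 + 1"] by (intro o(1)) simp_all
      show "markov_moment q (Suc m) = 0" if "1 \<le> m \<and> m < 1 + ((n div 2 + 3) div 3 - 1)" for m
        using that less_div_3[of m "n div 2 + 3"] by (intro o(2)) simp_all
    qed
    have cq: "moment_orth 0 1 (((n + 1) div 2 + 1) div 3) ((n div 2 + 3) div 3 - 1) q'"
      unfolding moment_orth_def using o(3,4) by auto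
    have deg: "degree p = Suc (degree q)"
      unfolding p_def using \<open>q \<noteq> 0\<close> by (subst degree_mult_eq) (auto simp: degree_monom_eq)
    have dg: "degree p = degree q'" using deg q(3) q'(3) 3 by presburger
    have db: "degree p \<le> ((n + 1) div 2 + 1) div 3 + ((n div 2 + 3) div 3 - 1) + 1"
      unfolding deg q(3) by (rule relation_count_2'[OF 3])
    have sd: "(n div 2 + 3) div 3 - 1 + 1 \<le> ((n + 1) div 2 + 1) div 3 + 1 + 0" by linarith
    have lp: "lead_coeff p = 1" unfolding p_def lead_coeff_mult using q(2) by (simp add: degree_monom_eq)
    have nd: "no_double_zeros 0 p q'" by (rule pencil[OF cp cq _ sd dg db lp q'(2) neq]) simp
    show ?thesis by (rule that[OF nd]) (simp_all add: 3 l p_def poly_monom)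
  qed
qed

end

section \<open>Passing from the star to the half-line\<close>

definition cube_push :: "(real \<Rightarrow> real) \<Rightarrow> real measure" where
  "cube_push w = distr (density lborel (\<lambda>x. ennreal (w x))) borel (\<lambda>x. x ^ 3)"

context
  fixes w :: "real \<Rightarrow> real"
  assumes w_int: "integrable lborel w" and w_nonneg: "\<And>x. 0 \<le> w x"
begin

lemma w_measurable [measurable]: "w \<in> borel_measurable borel"
  using borel_measurable_integrable[OF w_int] by simp

lemma sets_cube_push: "sets (cube_push w) = sets borel"
  by (simp add: cube_push_def)

lemma finite_cube_push: "finite_measure (cube_push w)"
proof -
  have "emeasure (density lborel (\<lambda>x. ennreal (w x))) UNIV = (\<integral>\<^sup>+x. ennreal (w x) \<partial>lborel)"
    by (simp add: emeasure_density)
  also have "\<dots> < \<infinity>" using w_int w_nonneg by (simp add: nn_integral_eq_integral)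
  finally have "finite_measure (density lborel (\<lambda>x. ennreal (w x)))" by (intro finite_measureI) (simp add: space_density)
  then show ?thesis unfolding cube_push_def by (rule finite_measure.finite_measure_distr) simp
qed

lemma AE_cube_push:
  assumes "{y. P y} \<in> sets borel"
  shows "(AE y in cube_push w. P y) \<longleftrightarrow> (AE x in lborel. 0 < w x \<longrightarrow> P (x ^ 3))"
proof -
  have "(AE y in cube_push w. P y) \<longleftrightarrow> (AE x in density lborel (\<lambda>x. ennreal (w x)). P (x ^ 3))"
    unfolding cube_push_def by (rule AE_distr_iff) (use assms in auto)
  also have "\<dots> \<longleftrightarrow> (AE x in lborel. 0 < w x \<longrightarrow> P (x ^ 3))"
    by (subst AE_density) auto
  finally show ?thesis .
qed

text \<open>Cubing is injective on the reals, so the preimage of a finite set is finite and Lebesgue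
  null.\<close>

lemma infinite_cube_push:
  assumes "\<not> (AE x in lborel. w x = 0)" "finite S"
  shows "\<not> (AE y in cube_push w. y \<in> S)"
proof
  assume "AE y in cube_push w. y \<in> S"
  moreover have "{y. y \<in> S} \<in> sets borel" using assms(2) by (simp add: finite_imp_closed borel_closed)
  ultimately have "AE x in lborel. 0 < w x \<longrightarrow> x ^ 3 \<in> S" by (simp add: AE_cube_push)
  moreover have "finite ((\<lambda>x::real. x ^ 3) -` S)"
    using assms(2) by (intro finite_vimageI) (auto intro!: injI dest: arg_cong[of _ _ "root 3"] simp: odd_real_root_power_cancel)
  then have "AE x in lborel. x \<notin> (\<lambda>x::real. x ^ 3) -` S"
    by (intro AE_not_in) (auto simp: finite_imp_null_set_lborel)
  ultimately have "AE x in lborel. w x = 0"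
    by eventually_elim (use w_nonneg in \<open>auto simp: less_le\<close>)
  with assms(1) show False by simp
qed

lemma integral_cube_push:
  fixes f :: "real \<Rightarrow> 'a::{banach, second_countable_topology}"
  assumes [measurable]: "f \<in> borel_measurable borel"
  shows "(\<integral>y. f y \<partial>cube_push w) = (\<integral>x. w x *\<^sub>R f (x ^ 3) \<partial>lborel)"
  unfolding cube_push_def using w_nonneg by (subst integral_distr) (auto simp: integral_density)

lemma integrable_cube_push:
  fixes f :: "real \<Rightarrow> 'a::{banach, second_countable_topology}"
  assumes [measurable]: "f \<in> borel_measurable borel"
  shows "integrable (cube_push w) f \<longleftrightarrow> integrable lborel (\<lambda>x. w x *\<^sub>R f (x ^ 3))"
  unfolding cube_push_def using w_nonneg by (subst integrable_distr_eq) (auto simp: integrable_density)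

end

declare w_measurable [measurable del]

section \<open>Cube roots of unity and splitting polynomials by exponent mod 3\<close>

lemma omega_cube: "omega ^ 3 = 1"
  unfolding omega_def Complex.DeMoivre by simp

lemma omega_nonzero: "omega \<noteq> 0"
  by (simp add: omega_def)

lemma omega_sum: "1 + omega + omega ^ 2 = 0"
proof -
  have "Re omega = - 1 / 2" by (simp add: omega_def cos_120)
  then have "omega \<noteq> 1" by auto
  moreover have "(omega - 1) * (1 + omega + omega ^ 2) = 0"
    using omega_cube by (simp add: algebra_simps power2_eq_square power3_eq_cube)
  ultimately show ?thesis by simp
qed

lemma omega_power_cube: "(omega ^ k) ^ 3 = 1"
  by (metis omega_cube power_mult power_mult mult.commute power_one)

text \<open>The roots of unity filter: it makes the sum over the rays keep only exponents divisible
  by three.\<close>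

lemma sum_omega_power: "(\<Sum>k<3. omega ^ (k * m)) = (if 3 dvd m then 3 else 0)"
proof -
  have 3: "(\<Sum>k<3. omega ^ (k * m)) = 1 + omega ^ m + (omega ^ m) ^ 2"
    by (simp add: numeral_3_eq_3 power_add power2_eq_square)
  have "omega ^ m = omega ^ (m mod 3)"
    by (metis omega_cube mult_div_mod_eq power_add power_mult power_one mult_1)
  moreover consider "m mod 3 = 0" | "m mod 3 = 1" | "m mod 3 = 2" by linarith
  then have "1 + omega ^ (m mod 3) + (omega ^ (m mod 3)) ^ 2 = (if m mod 3 = 0 then 3 else 0)"
  proof cases
    case 3
    have "omega ^ 4 = omega" using omega_cube by (simp add: eval_nat_numeral)
    then show ?thesis using 3 omega_sum by (simp add: add_ac flip: power_mult)
  qed (use omega_sum in simp_all)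
  ultimately show ?thesis unfolding 3 by (simp add: mod_eq_0_iff_dvd)
qed

definition sect :: "nat \<Rightarrow> complex poly \<Rightarrow> complex poly" where
  "sect l P = Poly (map (\<lambda>j. coeff P (3 * j + l)) [0..<Suc (degree P)])"

lemma coeff_sect: "coeff (sect l P) j = coeff P (3 * j + l)"
  unfolding sect_def coeff_Poly_eq nth_default_def length_map length_upt
  by (auto simp del: upt_Suc intro!: coeff_eq_0)

definition star :: "nat \<Rightarrow> complex poly \<Rightarrow> complex poly" where
  "star l q = monom 1 l * pcompose q (monom 1 3)"

lemma poly_star: "poly (star l q) t = t ^ l * poly q (t ^ 3)"
  by (simp add: star_def poly_monom poly_pcompose)

lemma degree_star: "q \<noteq> 0 \<Longrightarrow> degree (star l q) = 3 * degree q + l"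
  unfolding star_def by (subst degree_mult_eq) (auto simp: degree_monom_eq pcompose_eq_0_iff degree_pcompose)

lemma lead_coeff_star: "lead_coeff (star l q) = lead_coeff q"
  unfolding star_def lead_coeff_mult by (subst lead_coeff_comp) (auto simp: degree_monom_eq)

lemma poly_sum_lessThan:
  fixes p :: "'a::comm_semiring_1 poly"
  assumes "degree p < N"
  shows "poly p x = (\<Sum>i<N. coeff p i * x ^ i)"
  unfolding poly_altdef using assms by (intro sum.mono_neutral_left) (auto simp: coeff_eq_0)

lemma poly_sect: "poly P t = (\<Sum>l<3. t ^ l * poly (sect l P) (t ^ 3))"
proof -
  define D where "D = Suc (degree P)"
  have deg: "degree (sect l P) < D" for l
    unfolding D_def less_Suc_eq_le by (intro degree_le) (auto simp: coeff_sect intro!: coeff_eq_0)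
  have "poly P t = (\<Sum>i<D * 3. coeff P i * t ^ i)"
    by (intro poly_sum_lessThan) (simp add: D_def)
  also have "\<dots> = (\<Sum>j<D. \<Sum>i = j * 3..<j * 3 + 3. coeff P i * t ^ i)"
    by (rule sum.nat_group[symmetric])
  also have "\<dots> = (\<Sum>j<D. \<Sum>l<3. coeff P (3 * j + l) * t ^ (3 * j + l))"
  proof (rule sum.cong[OF refl])
    fix j
    show "(\<Sum>i = j * 3..<j * 3 + 3. coeff P i * t ^ i) = (\<Sum>l<3. coeff P (3 * j + l) * t ^ (3 * j + l))"
      using sum.shift_bounds_nat_ivl[of "\<lambda>i. coeff P i * t ^ i" 0 "j * 3" 3]
      by (simp add: atLeast0LessThan ac_simps)
  qed
  also have "\<dots> = (\<Sum>l<3. \<Sum>j<D. t ^ l * (coeff (sect l P) j * (t ^ 3) ^ j))"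
    by (subst sum.swap) (simp add: coeff_sect power_add mult_ac flip: power_mult)
  also have "\<dots> = (\<Sum>l<3. t ^ l * poly (sect l P) (t ^ 3))"
    by (simp only: poly_sum_lessThan[OF deg] sum_distrib_left)
  finally show ?thesis .
qed

lemma Re_poly_real: "Re (poly p (complex_of_real x)) = poly (map_poly Re p) x"
  and Im_poly_real: "Im (poly p (complex_of_real x)) = poly (map_poly Im p) x"
proof -
  have "degree (map_poly Re p) < Suc (degree p)" "degree (map_poly Im p) < Suc (degree p)"
    unfolding less_Suc_eq_le by (auto intro!: degree_le simp: coeff_map_poly coeff_eq_0)
  then show "Re (poly p (complex_of_real x)) = poly (map_poly Re p) x"
    "Im (poly p (complex_of_real x)) = poly (map_poly Im p) x"
    by (simp_all add: poly_sum_lessThan poly_sum_lessThan[of p, OF lessI] coeff_map_poly flip: of_real_power del: sum.lessThan_Suc)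
qed

section \<open>Integrals over the star as integrals on the half-line\<close>

locale star_system =
  fixes \<alpha> a b :: real and s1 s2 :: "real \<Rightarrow> real"
  assumes \<alpha>_pos: "0 < \<alpha>" and a_pos': "0 < a"
    and s1_nonneg: "\<forall>x\<in>{0<..<\<alpha>}. s1 x \<ge> 0" and s1_int: "set_integrable lborel {0<..<\<alpha>} s1"
    and s1_nz: "\<not> (AE x in lborel. x \<in> {0<..<\<alpha>} \<longrightarrow> s1 x = 0)"
    and s2_nonneg: "\<forall>t\<in>{-b..-a}. s2 t \<ge> 0" and s2_int: "set_integrable lborel {-b..-a} s2"
    and s2_nz: "\<not> (AE t in lborel. t \<in> {-b..-a} \<longrightarrow> s2 t = 0)"
begin

definition w1 :: "real \<Rightarrow> real" where "w1 x = indicator {0<..<\<alpha>} x * s1 x"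
definition w2 :: "real \<Rightarrow> real" where "w2 x = indicator {-b..-a} x * s2 x"

lemma w1: "integrable lborel w1" "0 \<le> w1 x"
  using s1_int s1_nonneg by (auto simp: w1_def[abs_def] set_integrable_def indicator_def)

lemma w2: "integrable lborel w2" "0 \<le> w2 x"
  using s2_int s2_nonneg by (auto simp: w2_def[abs_def] set_integrable_def indicator_def)

abbreviation "M \<equiv> cube_push w1"
abbreviation "N \<equiv> cube_push w2"

sublocale nikishin_pair M N "\<alpha> ^ 3" "a ^ 3" "b ^ 3"
proof (rule nikishin_pair.intro)
  show "finite_measure M" "finite_measure N" by (intro finite_cube_push w1 w2)+
  show "sets M = sets borel" "sets N = sets borel" by (intro sets_cube_push w1 w2)+
  have "AE x in lborel. 0 < w1 x \<longrightarrow> x ^ 3 \<in> {0<..<\<alpha> ^ 3}"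
    by (intro AE_I2) (auto simp: w1_def indicator_def intro: power_strict_mono)
  then show "AE x in M. x \<in> {0<..<\<alpha> ^ 3}" by (subst AE_cube_push[OF w1]) auto
  have "AE x in lborel. 0 < w2 x \<longrightarrow> x ^ 3 \<in> {- (b ^ 3)..- (a ^ 3)}"
  proof (intro AE_I2 impI)
    fix x assume "0 < w2 x"
    then have x: "a \<le> - x" "- x \<le> b" by (cases "x \<in> {-b..-a}"; simp add: w2_def)+
    then have "a ^ 3 \<le> (- x) ^ 3" "(- x) ^ 3 \<le> b ^ 3" using a_pos' by (intro power_mono; linarith)+
    then show "x ^ 3 \<in> {- (b ^ 3)..- (a ^ 3)}" by simp
  qed
  then show "AE t in N. t \<in> {- (b ^ 3)..- (a ^ 3)}" by (subst AE_cube_push[OF w2]) auto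
  show "0 < a ^ 3" using a_pos' by simp
  have "w1 x = 0 \<longleftrightarrow> (x \<in> {0<..<\<alpha>} \<longrightarrow> s1 x = 0)" for x by (auto simp: w1_def indicator_def)
  then have "\<not> (AE x in lborel. w1 x = 0)" using s1_nz by (simp only: not_False_eq_True)
  then show "finite S \<Longrightarrow> \<not> (AE x in M. x \<in> S)" for S by (intro infinite_cube_push w1)
  have "w2 x = 0 \<longleftrightarrow> (x \<in> {-b..-a} \<longrightarrow> s2 x = 0)" for x by (auto simp: w2_def indicator_def)
  then have "\<not> (AE x in lborel. w2 x = 0)" using s2_nz by (simp only: not_False_eq_True)
  then show "finite S \<Longrightarrow> \<not> (AE x in N. x \<in> S)" for S by (intro infinite_cube_push w2)
qed

text \<open>On ray k the power \<open>t ^ m\<close> contributes \<open>omega ^ (k * m)\<close>,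
  while \<open>t ^ 3\<close> is real and the same on all rays. What remains is the filter
  \<open>sum_omega_power\<close> times one real-variable integral, substituted by y = x^3.\<close>

lemma intS0_term:
  assumes "\<And>x. 0 < x \<Longrightarrow> x < \<alpha> \<Longrightarrow> G (complex_of_real (x ^ 3)) = g (x ^ 3)" and [measurable]: "g \<in> borel_measurable borel"
  shows "intS0 \<alpha> s1 (\<lambda>t. t ^ m * G (t ^ 3)) =
    (if 3 dvd m then 3 * (\<integral>y. complex_of_real (y ^ (m div 3)) * g y \<partial>M) else 0)"
proof -
  define J where "J = (\<integral>x. w1 x *\<^sub>R (complex_of_real (x ^ m) * g (x ^ 3)) \<partial>lborel)"
  have "(LINT x:{0<..<\<alpha>}|lborel. (omega ^ k * complex_of_real x) ^ m * G ((omega ^ k * complex_of_real x) ^ 3) * complex_of_real (s1 x))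
      = omega ^ (k * m) * J" for k
  proof -
    have "(LINT x:{0<..<\<alpha>}|lborel. (omega ^ k * complex_of_real x) ^ m * G ((omega ^ k * complex_of_real x) ^ 3) * complex_of_real (s1 x))
      = (\<integral>x. omega ^ (k * m) * (w1 x *\<^sub>R (complex_of_real (x ^ m) * g (x ^ 3))) \<partial>lborel)"
      unfolding set_lebesgue_integral_def
      by (intro Bochner_Integration.integral_cong refl)
        (auto simp: w1_def indicator_def power_mult_distrib omega_power_cube assms(1)[unfolded of_real_power]
            scaleR_conv_of_real power_mult mult_ac)
    then show ?thesis unfolding J_def integral_mult_right_zero .
  qed
  then have "intS0 \<alpha> s1 (\<lambda>t. t ^ m * G (t ^ 3)) = (\<Sum>k<3. omega ^ (k * m)) * J"
    unfolding intS0_def by (simp add: sum_distrib_right)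
  moreover have "J = (\<integral>y. complex_of_real (y ^ (m div 3)) * g y \<partial>M)" if "3 dvd m"
  proof -
    have "x ^ m = (x ^ 3) ^ (m div 3)" for x :: real using that by (simp flip: power_mult)
    then show ?thesis unfolding J_def by (subst integral_cube_push[OF w1]) simp_all
  qed
  ultimately show ?thesis by (auto simp: sum_omega_power)
qed

end

lemma coeff_pcompose_cube:
  fixes q :: "complex poly"
  shows "coeff (pcompose q (monom 1 3)) i = (if 3 dvd i then coeff q (i div 3) else 0)"
proof (induction q arbitrary: i)
  case (pCons c q)
  have "coeff (pcompose (pCons c q) (monom 1 3)) i =
    (if i = 0 then c else 0) + (if 3 \<le> i then coeff (pcompose q (monom 1 3)) (i - 3) else 0)"
    by (cases i) (auto simp: pcompose_pCons coeff_monom_mult)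
  also have "\<dots> = (if 3 dvd i then coeff (pCons c q) (i div 3) else 0)"
  proof (cases "3 \<le> i")
    case True
    then obtain j where "i = j + 3" by (metis le_add_diff_inverse2)
    then show ?thesis unfolding pCons.IH by simp
  qed (use dvd_imp_le[of 3 i] in auto)
  finally show ?case .
qed simp

lemma sect_star:
  assumes "l < 3" "l' < 3"
  shows "sect l' (star l q) = (if l' = l then q else 0)"
proof (rule poly_eqI)
  fix j
  have c: "coeff (star l q) i = (if l \<le> i \<and> 3 dvd (i - l) then coeff q ((i - l) div 3) else 0)" for i
    by (simp add: star_def coeff_monom_mult coeff_pcompose_cube)
  have "l' = l" if "l \<le> 3 * j + l'" "3 dvd (3 * j + l' - l)"
    using that assms by presburger
  then show "coeff (sect l' (star l q)) j = coeff (if l' = l then q else 0) j"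
    by (auto simp: coeff_sect c)
qed

context star_system
begin

abbreviation "ray k x \<equiv> omega ^ k * complex_of_real x"

lemma intS0_cong:
  assumes "\<And>k x. 0 < x \<Longrightarrow> x < \<alpha> \<Longrightarrow> F (ray k x) = H (ray k x)"
  shows "intS0 \<alpha> s1 F = intS0 \<alpha> s1 H"
  unfolding intS0_def using assms by (intro sum.cong set_lebesgue_integral_cong) auto

lemma intS0_lincomb:
  assumes "\<And>j k. j < 3 \<Longrightarrow> set_integrable lborel {0<..<\<alpha>} (\<lambda>x. F j (ray k x) * complex_of_real (s1 x))"
  shows "intS0 \<alpha> s1 (\<lambda>t. \<Sum>j<3::nat. c j * F j t) = (\<Sum>j<3. c j * intS0 \<alpha> s1 (F j))"
proof -
  have "(LINT x:{0<..<\<alpha>}|lborel. (\<Sum>j<3::nat. c j * F j (ray k x)) * complex_of_real (s1 x))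
      = (\<Sum>j<3. c j * (LINT x:{0<..<\<alpha>}|lborel. F j (ray k x) * complex_of_real (s1 x)))" for k
  proof -
    have "(LINT x:{0<..<\<alpha>}|lborel. (\<Sum>j<3::nat. c j * F j (ray k x)) * complex_of_real (s1 x))
      = (LINT x|lborel. (\<Sum>j<3. c j * (indicator {0<..<\<alpha>} x *\<^sub>R (F j (ray k x) * complex_of_real (s1 x)))))"
      unfolding set_lebesgue_integral_def
    proof (rule Bochner_Integration.integral_cong[OF refl])
      fix x
      show "indicat_real {0<..<\<alpha>} x *\<^sub>R ((\<Sum>j<3. c j * F j (ray k x)) * complex_of_real (s1 x)) =
          (\<Sum>j<3. c j * (indicat_real {0<..<\<alpha>} x *\<^sub>R (F j (ray k x) * complex_of_real (s1 x))))"
        by (cases "x \<in> {0<..<\<alpha>}") (simp_all add: sum_distrib_left sum_distrib_right mult_ac)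
    qed
    also have "\<dots> = (\<Sum>j<3. LINT x|lborel. c j * (indicator {0<..<\<alpha>} x *\<^sub>R (F j (ray k x) * complex_of_real (s1 x))))"
      using assms unfolding set_integrable_def
      by (intro Bochner_Integration.integral_sum integrable_mult_right) auto
    finally show ?thesis unfolding set_lebesgue_integral_def integral_mult_right_zero .
  qed
  then show ?thesis
    unfolding intS0_def by (simp only: sum_distrib_left) (rule sum.swap)
qed

lemma term_integrable:
  assumes G: "\<And>x. 0 < x \<Longrightarrow> x < \<alpha> \<Longrightarrow> G (complex_of_real (x ^ 3)) = g (x ^ 3)"
    and [measurable]: "g \<in> borel_measurable borel" and int: "integrable M g"
  shows "set_integrable lborel {0<..<\<alpha>} (\<lambda>x. ray k x ^ m * G (ray k x ^ 3) * complex_of_real (s1 x))"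
proof -
  have [measurable]: "w1 \<in> borel_measurable borel" using w_measurable[OF w1] .
  have "integrable lborel (\<lambda>x. w1 x *\<^sub>R (complex_of_real (x ^ m) * g (x ^ 3)))"
  proof (rule Bochner_Integration.integrable_bound)
    show "integrable lborel (\<lambda>x. \<alpha> ^ m *\<^sub>R (w1 x *\<^sub>R g (x ^ 3)))"
      using int by (intro integrable_scaleR_right) (simp add: integrable_cube_push[OF w1])
    have "norm (w1 x *\<^sub>R (complex_of_real (x ^ m) * g (x ^ 3))) \<le> norm (\<alpha> ^ m *\<^sub>R (w1 x *\<^sub>R g (x ^ 3)))" for x
    proof (cases "x \<in> {0<..<\<alpha>}")
      case True
      then have "x ^ m \<le> \<alpha> ^ m" by (intro power_mono) auto
      then have "x ^ m * (\<bar>w1 x\<bar> * norm (g (x ^ 3))) \<le> \<alpha> ^ m * (\<bar>w1 x\<bar> * norm (g (x ^ 3)))"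
        by (intro mult_right_mono) auto
      then show ?thesis using True \<alpha>_pos by (simp add: norm_mult norm_power abs_mult mult_ac)
    qed (simp add: w1_def)
    then show "AE x in lborel. norm (w1 x *\<^sub>R (complex_of_real (x ^ m) * g (x ^ 3))) \<le> norm (\<alpha> ^ m *\<^sub>R (w1 x *\<^sub>R g (x ^ 3)))"
      by simp
  qed measurable
  then have "integrable lborel (\<lambda>x. omega ^ (k * m) * (w1 x *\<^sub>R (complex_of_real (x ^ m) * g (x ^ 3))))"
    by (rule integrable_mult_right)
  also have "(\<lambda>x. omega ^ (k * m) * (w1 x *\<^sub>R (complex_of_real (x ^ m) * g (x ^ 3))))
      = (\<lambda>x. indicator {0<..<\<alpha>} x *\<^sub>R (ray k x ^ m * G (ray k x ^ 3) * complex_of_real (s1 x)))"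
    by (auto simp: w1_def indicator_def power_mult_distrib omega_power_cube G[unfolded of_real_power]
        scaleR_conv_of_real power_mult mult_ac)
  finally show ?thesis unfolding set_integrable_def .
qed

lemma complex_poly_integral:
  fixes g :: "real \<Rightarrow> real"
  assumes [measurable]: "g \<in> borel_measurable borel" and int: "\<And>p :: real poly. integrable M (\<lambda>y. poly p y * g y)"
  shows "integrable M (\<lambda>y. poly p (complex_of_real y) * complex_of_real (g y))" (is "integrable M ?f")
    "(\<integral>y. poly p (complex_of_real y) * complex_of_real (g y) \<partial>M) =
       Complex (\<integral>y. poly (map_poly Re p) y * g y \<partial>M) (\<integral>y. poly (map_poly Im p) y * g y \<partial>M)"
proof -
  have "?f = (\<lambda>y. complex_of_real (poly (map_poly Re p) y * g y) + \<i> * complex_of_real (poly (map_poly Im p) y * g y))"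
    by (auto simp: complex_eq_iff Re_poly_real Im_poly_real)
  then show i: "integrable M ?f"
    by (simp only:) (intro Bochner_Integration.integrable_add integrable_mult_right integrable_of_real int)
  show "(\<integral>y. ?f y \<partial>M) = Complex (\<integral>y. poly (map_poly Re p) y * g y \<partial>M) (\<integral>y. poly (map_poly Im p) y * g y \<partial>M)"
    using integral_Re[OF i] integral_Im[OF i] by (simp add: complex_eq_iff Re_poly_real Im_poly_real)
qed

lemma continuous_poly_complex: "continuous_on UNIV (\<lambda>y. poly p (complex_of_real y))"
  by (intro continuous_intros)

text \<open>Of the three sections of \<open>P\<close> only the one whose residue \<open>l\<close>
  makes \<open>l + k\<close> divisible by 3 survives the summation over rays. As the weight is real,
  its real and imaginary coefficients separate.\<close>

lemma intS0_poly:
  fixes g :: "real \<Rightarrow> real"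
  assumes G: "\<And>x. 0 < x \<Longrightarrow> x < \<alpha> \<Longrightarrow> G (complex_of_real (x ^ 3)) = complex_of_real (g (x ^ 3))"
    and [measurable]: "g \<in> borel_measurable borel" and int: "\<And>p :: real poly. integrable M (\<lambda>y. poly p y * g y)"
    and l: "l < 3" "3 * m = l + k"
  shows "intS0 \<alpha> s1 (\<lambda>t. poly P t * t ^ k * G (t ^ 3)) =
     3 * Complex (\<integral>y. poly (map_poly Re (sect l P)) y * y ^ m * g y \<partial>M)
       (\<integral>y. poly (map_poly Im (sect l P)) y * y ^ m * g y \<partial>M)"
proof -
  let ?F = "\<lambda>j t. t ^ (j + k) * (poly (sect j P) (t ^ 3) * G (t ^ 3))"
  let ?g = "\<lambda>j y. poly (sect j P) (complex_of_real y) * complex_of_real (g y)"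
  have [measurable]: "(\<lambda>y. poly p (complex_of_real y)) \<in> borel_measurable borel" for p
    by (intro borel_measurable_continuous_onI continuous_poly_complex)
  have [measurable]: "?g j \<in> borel_measurable borel" for j by measurable
  have G': "poly (sect j P) (complex_of_real (x ^ 3)) * G (complex_of_real (x ^ 3)) = ?g j (x ^ 3)"
    if "0 < x" "x < \<alpha>" for j x using G[OF that] by simp
  have "intS0 \<alpha> s1 (\<lambda>t. poly P t * t ^ k * G (t ^ 3)) = intS0 \<alpha> s1 (\<lambda>t. \<Sum>j<3. 1 * ?F j t)"
    by (subst poly_sect) (simp add: sum_distrib_left sum_distrib_right power_add mult_ac)
  also have "\<dots> = (\<Sum>j<3. 1 * intS0 \<alpha> s1 (?F j))"
  proof (rule intS0_lincomb)
    show "set_integrable lborel {0<..<\<alpha>} (\<lambda>x. ?F j (ray i x) * complex_of_real (s1 x))" for j i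
      by (rule term_integrable[where g = "?g j", OF G' _ complex_poly_integral(1)[OF _ int]]) measurable
  qed
  also have "\<dots> = (\<Sum>j<3. if 3 dvd j + k then 3 * (\<integral>y. complex_of_real (y ^ ((j + k) div 3)) * ?g j y \<partial>M) else 0)"
    by (simp only: mult_1 intS0_term[where G = "\<lambda>w. poly (sect _ P) w * G w" and g = "?g _", OF G'])
      (intro sum.cong refl; subst intS0_term[where g = "?g _"]; use G' in simp)
  also have "\<dots> = (\<Sum>j<3. if j = l then 3 * (\<integral>y. complex_of_real (y ^ m) * ?g l y \<partial>M) else 0)"
  proof (intro sum.cong refl)
    fix j :: nat assume "j \<in> {..<3}"
    then have j: "3 dvd j + k \<longleftrightarrow> j = l" using l by simp presburger
    have "(l + k) div 3 = m" using l by linarith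
    then show "(if 3 dvd j + k then 3 * (\<integral>y. complex_of_real (y ^ ((j + k) div 3)) * ?g j y \<partial>M) else 0) =
        (if j = l then 3 * (\<integral>y. complex_of_real (y ^ m) * ?g l y \<partial>M) else 0)" unfolding j by auto
  qed
  also have "\<dots> = 3 * (\<integral>y. complex_of_real (y ^ m) * ?g l y \<partial>M)" using l by simp
  also have "(\<integral>y. complex_of_real (y ^ m) * ?g l y \<partial>M) =
      (\<integral>y. poly (sect l P) (complex_of_real y) * complex_of_real (y ^ m * g y) \<partial>M)"
    by (simp add: mult_ac)
  also have "\<dots> = Complex (\<integral>y. poly (map_poly Re (sect l P)) y * (y ^ m * g y) \<partial>M)
       (\<integral>y. poly (map_poly Im (sect l P)) y * (y ^ m * g y) \<partial>M)"
  proof (rule complex_poly_integral)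
    show "integrable M (\<lambda>y. poly p y * (y ^ m * g y))" for p
      using int[of "p * monom 1 m"] by (simp add: poly_monom mult_ac)
  qed measurable
  finally show ?thesis by (simp add: mult_ac)
qed

definition markov_complex :: "complex \<Rightarrow> complex" where
  "markov_complex z = (LINT t:{-b..-a}|lborel. complex_of_real (s2 t) / (z - complex_of_real t ^ 3))"

lemma fM_eq: "fM a b s2 z = z ^ 2 * markov_complex (z ^ 3)"
  by (simp add: fM_def markov_complex_def)

lemma markov_complex_real: "markov_complex (complex_of_real y) = complex_of_real (markov y)"
proof -
  have "markov_complex (complex_of_real y) = (LINT t|lborel. complex_of_real (w2 t * (1 / (y - t ^ 3))))"
    unfolding markov_complex_def set_lebesgue_integral_def
    by (intro Bochner_Integration.integral_cong refl) (auto simp: w2_def indicator_def)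
  also have "\<dots> = complex_of_real (\<integral>t. w2 t * (1 / (y - t ^ 3)) \<partial>lborel)" by (rule integral_complex_of_real)
  also have "(\<integral>t. w2 t * (1 / (y - t ^ 3)) \<partial>lborel) = markov y"
    unfolding markov_def by (subst integral_cube_push[OF w2]) simp_all
  finally show ?thesis .
qed

section \<open>Identification of \<open>Qpoly\<close> and \<open>Psi\<close> in the cubed
  variable\<close>

lemma Qcond_iff:
  "Qcond \<alpha> s1 (fM a b s2) n P \<longleftrightarrow>
     (\<forall>l<3. star_orth l n (map_poly Re (sect l P)) \<and> star_orth l n (map_poly Im (sect l P)))"
proof -
  let ?R = "\<lambda>l. map_poly Re (sect l P)" and ?I = "\<lambda>l. map_poly Im (sect l P)"
  \<comment> \<open>The two parities merge, since \<open>(n + 1) div 2\<close> is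
    \<open>n div 2\<close> for even n and one more for odd n.\<close>
  have Q: "Qcond \<alpha> s1 (fM a b s2) n P \<longleftrightarrow>
     (\<forall>k < (n + 1) div 2. intS0 \<alpha> s1 (\<lambda>t. poly P t * t ^ k) = 0) \<and>
     (\<forall>k < n div 2. intS0 \<alpha> s1 (\<lambda>t. poly P t * t ^ k * fM a b s2 t) = 0)"
    unfolding Qcond_def by (auto elim!: evenE oddE simp: less_Suc_eq_le)
  have 1: "intS0 \<alpha> s1 (\<lambda>t. poly P t * t ^ k) = 3 * Complex (moment (?R l) m) (moment (?I l) m)"
    if "l < 3" "3 * m = l + k" for l m k
    using intS0_poly[of "\<lambda>_. 1" "\<lambda>_. 1" l m k P] that integrable_poly by (simp add: moment_def)
  have 2: "intS0 \<alpha> s1 (\<lambda>t. poly P t * t ^ k * fM a b s2 t) = 3 * Complex (markov_moment (?R l) m) (markov_moment (?I l) m)"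
    if "l < 3" "3 * m = l + k + 2" for l m k
  proof -
    have "intS0 \<alpha> s1 (\<lambda>t. poly P t * t ^ (k + 2) * markov_complex (t ^ 3)) = 3 * Complex (markov_moment (?R l) m) (markov_moment (?I l) m)"
      using that unfolding markov_moment_def by (intro intS0_poly markov_complex_real integrable_markov) auto
    then show ?thesis by (simp add: fM_eq power_add power2_eq_square mult_ac)
  qed
  have C0: "3 * Complex x y = 0 \<longleftrightarrow> x = 0 \<and> y = 0" for x y by (simp add: complex_eq_iff)
  show ?thesis
  proof
    assume L: "Qcond \<alpha> s1 (fM a b s2) n P"
    show "\<forall>l<3. star_orth l n (?R l) \<and> star_orth l n (?I l)"
    proof (intro allI impI)
      fix l :: nat assume l: "l < 3"
      have "moment (?R l) m = 0 \<and> moment (?I l) m = 0" if m: "l \<le> 3 * m" "3 * m < (n + 1) div 2 + l" for m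
      proof -
        have "3 * m - l < (n + 1) div 2" using m by linarith
        with L have "intS0 \<alpha> s1 (\<lambda>t. poly P t * t ^ (3 * m - l)) = 0" unfolding Q by blast
        then show ?thesis using 1[of l m "3 * m - l"] l m by (simp add: complex_eq_iff)
      qed
      moreover have "markov_moment (?R l) m = 0 \<and> markov_moment (?I l) m = 0" if m: "l + 2 \<le> 3 * m" "3 * m < n div 2 + l + 2" for m
      proof -
        have "3 * m - l - 2 < n div 2" using m by linarith
        with L have "intS0 \<alpha> s1 (\<lambda>t. poly P t * t ^ (3 * m - l - 2) * fM a b s2 t) = 0" unfolding Q by blast
        then show ?thesis using 2[of l m "3 * m - l - 2"] l m by (simp add: complex_eq_iff)
      qed
      ultimately show "star_orth l n (?R l) \<and> star_orth l n (?I l)" unfolding star_orth_def by blast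
    qed
  next
    assume R: "\<forall>l<3. star_orth l n (?R l) \<and> star_orth l n (?I l)"
    have "intS0 \<alpha> s1 (\<lambda>t. poly P t * t ^ k) = 0" if k: "k < (n + 1) div 2" for k
    proof -
      have "\<exists>l m. l < 3 \<and> 3 * m = l + k" by presburger
      then obtain l m where lm: "l < 3" "3 * m = l + k" by blast
      then have "moment (?R l) m = 0 \<and> moment (?I l) m = 0" using R k unfolding star_orth_def by (metis add.commute add_less_cancel_right le_add1)
      then show ?thesis unfolding 1[OF lm] C0 .
    qed
    moreover have "intS0 \<alpha> s1 (\<lambda>t. poly P t * t ^ k * fM a b s2 t) = 0" if k: "k < n div 2" for k
    proof -
      have "\<exists>l m. l < 3 \<and> 3 * m = l + k + 2" by presburger
      then obtain l m where lm: "l < 3" "3 * m = l + k + 2" by blast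
      then have "l + 2 \<le> 3 * m" "3 * m < n div 2 + l + 2" using k by linarith+
      then have "markov_moment (?R l) m = 0 \<and> markov_moment (?I l) m = 0" using R lm(1) unfolding star_orth_def by blast
      then show ?thesis unfolding 2[OF lm] C0 .
    qed
    ultimately show "Qcond \<alpha> s1 (fM a b s2) n P" unfolding Q by blast
  qed
qed

text \<open>The conditions are linear, so each section of the difference satisfies the relations of
  its residue class. If the difference had degree below n, normality would annihilate all of its
  sections.\<close>

lemma Qcond_unique:
  assumes "Qcond \<alpha> s1 (fM a b s2) n P" "Qcond \<alpha> s1 (fM a b s2) n P'" "P \<noteq> P'"
  shows "n \<le> degree (P - P')"
proof (rule ccontr)
  assume deg: "\<not> n \<le> degree (P - P')"
  \<comment> \<open>\<open>\<rho>\<close> stands for \<open>Re\<close> and for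
    \<open>Im\<close>.\<close>
  have zero: "map_poly \<rho> (sect l (P - P')) = 0"
    if l: "l < 3" and \<rho>: "\<rho> 0 = 0" "\<And>x y. \<rho> (x - y) = \<rho> x - \<rho> y"
      and so: "star_orth l n (map_poly \<rho> (sect l P))" "star_orth l n (map_poly \<rho> (sect l P'))"
    for l and \<rho> :: "complex \<Rightarrow> real"
  proof (rule ccontr)
    define h where "h = map_poly \<rho> (sect l (P - P'))"
    assume "map_poly \<rho> (sect l (P - P')) \<noteq> 0"
    then have "lead_coeff h \<noteq> 0" by (simp add: h_def)
    then have "coeff (P - P') (3 * degree h + l) \<noteq> 0"
      using \<rho>(1) by (auto simp: h_def coeff_map_poly coeff_sect simp del: leading_coeff_0_iff)
    then have "3 * degree h + l < n" using deg le_degree[of "P - P'" "3 * degree h + l"] by linarith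
    moreover have "h = smult 1 (map_poly \<rho> (sect l P)) + smult (- 1) (map_poly \<rho> (sect l P'))"
      by (rule poly_eqI) (simp add: h_def coeff_map_poly coeff_sect \<rho>)
    then have "star_orth l n h" using so by (simp only: star_orth_iff_moment_orth moment_orth_add)
    ultimately have "h = 0" using l star_orth_zero by blast
    with \<open>lead_coeff h \<noteq> 0\<close> show False by simp
  qed
  have "coeff (P - P') i = 0" for i
  proof -
    have l: "i mod 3 < 3" by simp
    have "map_poly Re (sect (i mod 3) (P - P')) = 0" "map_poly Im (sect (i mod 3) (P - P')) = 0"
      using assms(1,2) l unfolding Qcond_iff by (auto intro!: zero)
    then have "coeff (map_poly Re (sect (i mod 3) (P - P'))) (i div 3) = 0"
      "coeff (map_poly Im (sect (i mod 3) (P - P'))) (i div 3) = 0" by simp_all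
    then have "Re (coeff (sect (i mod 3) (P - P')) (i div 3)) = 0" "Im (coeff (sect (i mod 3) (P - P')) (i div 3)) = 0"
      by (simp_all add: coeff_map_poly)
    then show ?thesis by (simp add: coeff_sect complex_eq_iff)
  qed
  then have "P - P' = 0" by (intro poly_eqI) simp
  with assms(3) show False by simp
qed

text \<open>Comparing a monic solution with the solution 0 shows that its degree is at least n. Two
  monic solutions of degree n differ by less than degree n, hence not at all, so the choice in
  \<open>Qpoly\<close> has only one candidate.\<close>

lemma Qpoly_eq:
  obtains q where "Qpoly \<alpha> s1 (fM a b s2) n = star (n mod 3) (map_poly of_real q)"
    "star_orth (n mod 3) n q" "lead_coeff q = 1" "degree q = n div 3"
proof -
  obtain q where q: "star_orth (n mod 3) n q" "lead_coeff q = 1" "degree q = n div 3" by (rule exists_star_orth)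
  define c where "c = map_poly complex_of_real q"
  define P where "P = star (n mod 3) c"
  have re: "map_poly Re c = q" "map_poly Im c = 0"
    by (auto intro!: poly_eqI simp: c_def coeff_map_poly)
  have dc: "degree c = n div 3" "lead_coeff c = 1"
    using q by (simp_all add: c_def degree_map_poly coeff_map_poly)
  then have "c \<noteq> 0" by auto
  then have P: "degree P = n" "lead_coeff P = 1" 
    unfolding P_def lead_coeff_star using dc(2) by (simp_all add: degree_star dc(1))
  have zero: "star_orth l n 0" for l by (simp add: star_orth_def moment_0 markov_moment_0)
  have "Qcond \<alpha> s1 (fM a b s2) n P"
    unfolding Qcond_iff P_def using q(1) zero by (auto simp: sect_star re)
  moreover have "Qcond \<alpha> s1 (fM a b s2) n 0"
  proof -
    have "sect l 0 = 0" for l by (rule poly_eqI) (simp add: coeff_sect)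
    then show ?thesis unfolding Qcond_iff using zero by simp
  qed
  ultimately have min: "n \<le> degree R" if "Qcond \<alpha> s1 (fM a b s2) n R" "lead_coeff R = 1" for R
    using Qcond_unique[OF that(1), of 0] that(2) by fastforce
  have "Qpoly \<alpha> s1 (fM a b s2) n = P"
    unfolding Qpoly_def
  proof (rule some_equality)
    show "lead_coeff P = 1 \<and> Qcond \<alpha> s1 (fM a b s2) n P \<and>
        (\<forall>p. lead_coeff p = 1 \<and> Qcond \<alpha> s1 (fM a b s2) n p \<longrightarrow> degree P \<le> degree p)"
      using P \<open>Qcond \<alpha> s1 (fM a b s2) n P\<close> min by simp
    fix R assume R: "lead_coeff R = 1 \<and> Qcond \<alpha> s1 (fM a b s2) n R \<and>
        (\<forall>p. lead_coeff p = 1 \<and> Qcond \<alpha> s1 (fM a b s2) n p \<longrightarrow> degree R \<le> degree p)"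
    then have dR: "degree R = n" using min[of R] P \<open>Qcond \<alpha> s1 (fM a b s2) n P\<close> by (metis antisym)
    show "R = P"
    proof (rule ccontr)
      assume "R \<noteq> P"
      then have n: "n \<le> degree (R - P)" using R \<open>Qcond \<alpha> s1 (fM a b s2) n P\<close> by (intro Qcond_unique) auto
      have "coeff (R - P) n = 0" using R P dR by simp
      moreover have "degree (R - P) \<le> n" using degree_diff_le_max[of R P] P dR by simp
      ultimately have "lead_coeff (R - P) = 0" using n by simp
      then have "R - P = 0" by (simp only: leading_coeff_0_iff)
      with \<open>R \<noteq> P\<close> show False by simp
    qed
  qed
  then show ?thesis using q by (intro that[of q]) (simp_all add: P_def c_def)
qed

lemma poly_of_real: "poly (map_poly complex_of_real q) (complex_of_real x) = complex_of_real (poly q x)"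
  by (induction q) (simp_all add: map_poly_pCons)

text \<open>Expanding 1/(t-z) = (z^2 + z t + t^2)/(t^3 - z^3) leaves a denominator that is the same
  on all rays. Of the three terms \<open>z ^ (2 - j) * t ^ j\<close> only the one with
  \<open>l + j\<close> divisible by 3 survives; it has \<open>2 - j = (l + 2) mod 3\<close> and
  \<open>(l + j) div 3 = (l + 2) div 3\<close>.\<close>

lemma Psi_eq:
  assumes Q: "Qpoly \<alpha> s1 (fM a b s2) n = star l (map_poly of_real q)" and l: "l < 3"
    and z: "z ^ 3 = complex_of_real y" "y < 0"
  shows "Psi \<alpha> s1 (fM a b s2) n z = 3 * z ^ ((l + 2) mod 3) * complex_of_real (cauchy 1 (monom 1 ((l + 2) div 3) * q) y)"
proof -
  define c where "c = map_poly complex_of_real q"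
  define G where "G = (\<lambda>w. poly c w / (w - complex_of_real y))"
  define g where "g = (\<lambda>x. complex_of_real (poly q x / (x - y)))"
  let ?F = "\<lambda>j t. t ^ (l + j) * G (t ^ 3)"
  have gm [measurable]: "g \<in> borel_measurable borel" unfolding g_def by measurable
  have nf: "nonneg_free 1" by (simp add: nonneg_free_def)
  have gi: "integrable M g" unfolding g_def
    using integrable_cauchy[OF nf z(2), of q] by (intro integrable_of_real) simp
  have Gg: "G (complex_of_real (x ^ 3)) = g (x ^ 3)" for x
    unfolding G_def g_def c_def by (simp only: poly_of_real of_real_divide of_real_diff)
  have "Psi \<alpha> s1 (fM a b s2) n z = intS0 \<alpha> s1 (\<lambda>t. \<Sum>j<3. z ^ (2 - j) * ?F j t)"
    unfolding Psi_def Q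
  proof (rule intS0_cong)
    fix k x assume x: "0 < x" "x < \<alpha>"
    define t where "t = ray k x"
    have t3: "t ^ 3 = complex_of_real (x ^ 3)" by (simp add: t_def power_mult_distrib omega_power_cube)
    have "x ^ 3 > 0" using x by simp
    then have "x ^ 3 \<noteq> y" using z by linarith
    then have ne: "t ^ 3 - z ^ 3 \<noteq> 0" unfolding t3 z by (simp flip: of_real_diff of_real_power)
    have fac: "t ^ 3 - z ^ 3 = (t - z) * (z ^ 2 + z * t + t ^ 2)" by (simp add: algebra_simps power2_eq_square power3_eq_cube)
    with ne have ne': "t - z \<noteq> 0" "z ^ 2 + z * t + t ^ 2 \<noteq> 0" by auto
    have "poly (star l (map_poly complex_of_real q)) t / (t - z) = t ^ l * poly c (t ^ 3) * (z ^ 2 + z * t + t ^ 2) / (t ^ 3 - z ^ 3)"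
      unfolding poly_star c_def fac using ne' by simp
    also have "\<dots> = (\<Sum>j<3. z ^ (2 - j) * ?F j t)"
      unfolding G_def z(1)[symmetric] by (simp add: numeral_3_eq_3 power_add power2_eq_square algebra_simps add_divide_distrib)
    finally show "poly (star l (map_poly complex_of_real q)) (ray k x) / (ray k x - z) = (\<Sum>j<3. z ^ (2 - j) * ?F j (ray k x))"
      unfolding t_def .
  qed
  also have "\<dots> = (\<Sum>j<3. z ^ (2 - j) * intS0 \<alpha> s1 (?F j))"
    by (intro intS0_lincomb term_integrable[where g = g] Gg gm gi)
  also have "\<dots> = (\<Sum>j<3. z ^ (2 - j) * (if 3 dvd l + j then 3 * complex_of_real (cauchy 1 (monom 1 ((l + j) div 3) * q) y) else 0))"
  proof (intro sum.cong refl arg_cong2[where f = "(*)"])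
    fix j
    have "(\<integral>x. complex_of_real (x ^ m) * g x \<partial>M) = complex_of_real (cauchy 1 (monom 1 m * q) y)" for m
    proof -
      have "(\<integral>x. complex_of_real (x ^ m) * g x \<partial>M) = (\<integral>x. complex_of_real (poly (monom 1 m * q) x / (poly 1 x * (x - y))) \<partial>M)"
        by (simp add: g_def poly_monom)
      then show ?thesis unfolding cauchy_def by (simp only: integral_complex_of_real)
    qed
    then show "intS0 \<alpha> s1 (?F j) = (if 3 dvd l + j then 3 * complex_of_real (cauchy 1 (monom 1 ((l + j) div 3) * q) y) else 0)"
      by (subst intS0_term[OF Gg gm]) simp
  qed
  also have "\<dots> = 3 * z ^ ((l + 2) mod 3) * complex_of_real (cauchy 1 (monom 1 ((l + 2) div 3) * q) y)"
  proof -
    consider "l = 0" | "l = 1" | "l = 2" using l by linarith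
    moreover have "(\<Sum>j<3. f j) = f 0 + f 1 + f 2" for f :: "nat \<Rightarrow> complex"
      by (simp add: numeral_3_eq_3 numeral_2_eq_2)
    moreover have "\<not> 3 dvd Suc (Suc 0)" "3 dvd Suc (Suc (Suc 0))" by presburger+
    ultimately show ?thesis by cases (simp_all add: power2_eq_square)
  qed
  finally show ?thesis .
qed

section \<open>Transfer of simple zeros and interlacing through the cube map\<close>

lemma cauchy_has_derivative:
  assumes "x < 0"
  shows "((\<lambda>x. cauchy 1 H (x ^ 3)) has_real_derivative cauchy [:-(x ^ 3), 1:] H (x ^ 3) * (3 * x ^ 2)) (at x)"
proof -
  have "x ^ 3 < 0" using assms by simp
  then have "(cauchy 1 H has_real_derivative cauchy (1 * [:-(x ^ 3), 1:]) H (x ^ 3)) (at (x ^ 3))"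
    by (intro cauchy_deriv) (auto simp: nonneg_free_def)
  then show ?thesis by (intro DERIV_chain2[where f = "cauchy 1 H"]) (auto intro!: derivative_eq_intros)
qed

lemma poly_cube_has_derivative:
  "((\<lambda>x. poly p (x ^ 3)) has_real_derivative poly (pderiv p) (x ^ 3) * (3 * x ^ 2)) (at (x::real))"
  by (rule DERIV_chain2[where f = "poly p", OF poly_DERIV]) (auto intro!: derivative_eq_intros)

lemma no_double_zerosD:
  assumes "no_double_zeros e p q" "A \<noteq> 0 \<or> B \<noteq> 0"
  shows "A * poly p y + B * poly q y = 0 \<Longrightarrow> A * poly (pderiv p) y + B * poly (pderiv q) y \<noteq> 0"
    "y < 0 \<Longrightarrow> A * cauchy 1 (monom 1 e * p) y + B * cauchy 1 (monom 1 e * q) y = 0 \<Longrightarrow>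
      A * cauchy [:-y, 1:] (monom 1 e * p) y + B * cauchy [:-y, 1:] (monom 1 e * q) y \<noteq> 0"
  using assms unfolding no_double_zeros_def by blast+

lemma no_double_zeros_no_common:
  assumes "no_double_zeros e p q"
  shows "\<not> (poly p y = 0 \<and> poly q y = 0)"
    "y < 0 \<Longrightarrow> \<not> (cauchy 1 (monom 1 e * p) y = 0 \<and> cauchy 1 (monom 1 e * q) y = 0)"
proof -
  show "\<not> (poly p y = 0 \<and> poly q y = 0)"
    using no_double_zerosD(1)[OF assms, of 1 0 y]
      no_double_zerosD(1)[OF assms, of "- poly (pderiv q) y" "poly (pderiv p) y" y]
    by (auto simp: mult.commute)
  show "\<not> (cauchy 1 (monom 1 e * p) y = 0 \<and> cauchy 1 (monom 1 e * q) y = 0)" if "y < 0"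
    using no_double_zerosD(2)[OF assms, of 1 0 y] that
      no_double_zerosD(2)[OF assms, of "- cauchy [:-y, 1:] (monom 1 e * q) y" "cauchy [:-y, 1:] (monom 1 e * p) y" y]
    by (auto simp: mult.commute)
qed

lemma no_double_zeros_sym: "no_double_zeros e p q \<Longrightarrow> no_double_zeros e q p"
  unfolding no_double_zeros_def by (metis add.commute)

lemma chain_factor:
  "A * (u * (3 * x ^ 2)) + B * (v * (3 * x ^ 2)) = 0 \<Longrightarrow> x \<noteq> 0 \<Longrightarrow> A * u + B * v = 0"
  for A B u v x :: real
proof -
  have "A * (u * (3 * x ^ 2)) + B * (v * (3 * x ^ 2)) = (A * u + B * v) * (3 * x ^ 2)" by (simp add: algebra_simps)
  then show "A * (u * (3 * x ^ 2)) + B * (v * (3 * x ^ 2)) = 0 \<Longrightarrow> x \<noteq> 0 \<Longrightarrow> A * u + B * v = 0" by simp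
qed

lemma interlacing_poly:
  fixes u v :: "real \<Rightarrow> complex"
  assumes nd: "no_double_zeros e p q"
    and uv: "\<And>x. x \<in> {0<..<\<alpha>} \<Longrightarrow> u x = 0 \<longleftrightarrow> poly p (x ^ 3) = 0"
      "\<And>x. x \<in> {0<..<\<alpha>} \<Longrightarrow> v x = 0 \<longleftrightarrow> poly q (x ^ 3) = 0"
    and cz: "consec_zeros u {0<..<\<alpha>} x y"
  shows "\<exists>!z. x < z \<and> z < y \<and> v z = 0"
proof (rule interlacing[OF _ _ _ _ uv cz])
  show "((\<lambda>x. poly p (x ^ 3)) has_real_derivative poly (pderiv p) (z ^ 3) * (3 * z ^ 2)) (at z)"
    "((\<lambda>x. poly q (x ^ 3)) has_real_derivative poly (pderiv q) (z ^ 3) * (3 * z ^ 2)) (at z)" for z :: real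
    by (rule poly_cube_has_derivative)+
  show False if "z \<in> {0<..<\<alpha>}" "A \<noteq> 0 \<or> B \<noteq> 0" "A * poly p (z ^ 3) + B * poly q (z ^ 3) = 0"
    "A * (poly (pderiv p) (z ^ 3) * (3 * z ^ 2)) + B * (poly (pderiv q) (z ^ 3) * (3 * z ^ 2)) = 0" for A B z
    using no_double_zerosD(1)[OF nd that(2,3)] chain_factor[OF that(4)] that(1) by simp
qed auto

lemma interlacing_cauchy:
  fixes u v :: "real \<Rightarrow> complex"
  assumes nd: "no_double_zeros e p q"
    and uv: "\<And>x. x \<in> {-b<..<-a} \<Longrightarrow> u x = 0 \<longleftrightarrow> cauchy 1 (monom 1 e * p) (x ^ 3) = 0"
      "\<And>x. x \<in> {-b<..<-a} \<Longrightarrow> v x = 0 \<longleftrightarrow> cauchy 1 (monom 1 e * q) (x ^ 3) = 0"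
    and cz: "consec_zeros u {-b<..<-a} x y"
  shows "\<exists>!z. x < z \<and> z < y \<and> v z = 0"
proof (rule interlacing[OF _ _ _ _ uv cz])
  let ?H = "monom 1 e * p" and ?K = "monom 1 e * q"
  have neg: "z < 0" "z ^ 3 < 0" if "z \<in> {-b<..<-a}" for z
  proof -
    show "z < 0" using that a_pos' by simp
    then show "z ^ 3 < 0" by simp
  qed
  show "((\<lambda>x. cauchy 1 ?H (x ^ 3)) has_real_derivative cauchy [:-(z ^ 3), 1:] ?H (z ^ 3) * (3 * z ^ 2)) (at z)"
    "((\<lambda>x. cauchy 1 ?K (x ^ 3)) has_real_derivative cauchy [:-(z ^ 3), 1:] ?K (z ^ 3) * (3 * z ^ 2)) (at z)"
    if "z \<in> {-b<..<-a}" for z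
    by (rule cauchy_has_derivative[OF neg(1)[OF that]])+
  show False if z: "z \<in> {-b<..<-a}" and AB: "A \<noteq> 0 \<or> B \<noteq> 0"
    and 0: "A * cauchy 1 ?H (z ^ 3) + B * cauchy 1 ?K (z ^ 3) = 0"
      "A * (cauchy [:-(z ^ 3), 1:] ?H (z ^ 3) * (3 * z ^ 2)) + B * (cauchy [:-(z ^ 3), 1:] ?K (z ^ 3) * (3 * z ^ 2)) = 0"
    for A B z
    using no_double_zerosD(2)[OF nd AB neg(2)[OF z] 0(1)] chain_factor[OF 0(2)] neg(1)[OF z] by blast
qed auto

lemma S0_E:
  assumes "z \<in> S0 \<alpha> - {0}"
  obtains x where "0 < x" "x \<le> \<alpha>" "z ^ 3 = complex_of_real (x ^ 3)"
proof -
  from assms obtain k x where x: "z = ray k x" "0 \<le> x" "x \<le> \<alpha>" "z \<noteq> 0" by (auto simp: S0_def)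
  then have "x \<noteq> 0" by auto
  with x show ?thesis by (intro that[of x]) (auto simp: power_mult_distrib omega_power_cube)
qed

lemma S1_E:
  assumes "z \<in> S1 a b"
  obtains x where "x < 0" "z ^ 3 = complex_of_real (x ^ 3)" "z \<noteq> 0"
proof -
  from assms obtain k x where x: "z = ray k x" "x \<le> - a" by (auto simp: S1_def)
  with a_pos' show ?thesis by (intro that[of x]) (auto simp: power_mult_distrib omega_power_cube omega_nonzero)
qed

theorem zeros_interlace:
  defines "Q \<equiv> Qpoly \<alpha> s1 (fM a b s2)" and "\<Psi> \<equiv> Psi \<alpha> s1 (fM a b s2)"
  shows "(\<forall>z \<in> S0 \<alpha> - {0}. \<not> (poly (Q n) z = 0 \<and> poly (Q (Suc n)) z = 0)) \<and>
     (\<forall>x y. consec_zeros (\<lambda>t. poly (Q n) (complex_of_real t)) {0<..<\<alpha>} x y \<longrightarrow>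
        (\<exists>!z. x < z \<and> z < y \<and> poly (Q (Suc n)) (complex_of_real z) = 0)) \<and>
     (\<forall>x y. consec_zeros (\<lambda>t. poly (Q (Suc n)) (complex_of_real t)) {0<..<\<alpha>} x y \<longrightarrow>
        (\<exists>!z. x < z \<and> z < y \<and> poly (Q n) (complex_of_real z) = 0)) \<and>
     (\<forall>z \<in> S1 a b. \<not> (\<Psi> n z = 0 \<and> \<Psi> (Suc n) z = 0)) \<and>
     (\<forall>x y. consec_zeros (\<lambda>t. \<Psi> n (complex_of_real t)) {-b<..<-a} x y \<longrightarrow>
        (\<exists>!z. x < z \<and> z < y \<and> \<Psi> (Suc n) (complex_of_real z) = 0)) \<and>
     (\<forall>x y. consec_zeros (\<lambda>t. \<Psi> (Suc n) (complex_of_real t)) {-b<..<-a} x y \<longrightarrow>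
        (\<exists>!z. x < z \<and> z < y \<and> \<Psi> n (complex_of_real z) = 0))"
proof -
  let ?e = "\<lambda>n :: nat. (n mod 3 + 2) div 3"
  obtain q where q: "Q n = star (n mod 3) (map_poly of_real q)" "star_orth (n mod 3) n q" "lead_coeff q = 1" "degree q = n div 3"
    unfolding Q_def by (rule Qpoly_eq)
  obtain q' where q': "Q (Suc n) = star (Suc n mod 3) (map_poly of_real q')" "star_orth (Suc n mod 3) (Suc n) q'"
    "lead_coeff q' = 1" "degree q' = Suc n div 3"
    unfolding Q_def by (rule Qpoly_eq)
  have Qz: "poly (Q n) z = 0 \<longleftrightarrow> poly q y = 0" "poly (Q (Suc n)) z = 0 \<longleftrightarrow> poly q' y = 0"
    if "z ^ 3 = complex_of_real y" "z \<noteq> 0" for z y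
    using that unfolding q(1) q'(1) poly_star by (simp_all add: poly_of_real)
  have Pz: "\<Psi> n z = 0 \<longleftrightarrow> cauchy 1 (monom 1 (?e n) * q) y = 0"
    "\<Psi> (Suc n) z = 0 \<longleftrightarrow> cauchy 1 (monom 1 (?e (Suc n)) * q') y = 0"
    if "z ^ 3 = complex_of_real y" "z \<noteq> 0" "y < 0" for z y
    using that Psi_eq[OF q(1)[unfolded Q_def] _ that(1,3)] Psi_eq[OF q'(1)[unfolded Q_def] _ that(1,3)]
    unfolding \<Psi>_def by simp_all
  have Qr: "poly (Q n) (complex_of_real x) = 0 \<longleftrightarrow> poly q (x ^ 3) = 0"
    "poly (Q (Suc n)) (complex_of_real x) = 0 \<longleftrightarrow> poly q' (x ^ 3) = 0" if "x \<in> {0<..<\<alpha>}" for x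
    using that by (intro Qz; simp)+
  have neg: "x < 0" "x ^ 3 < 0" if "x \<in> {-b<..<-a}" for x
  proof -
    show "x < 0" using that a_pos' by simp
    then show "x ^ 3 < 0" by simp
  qed
  have Pr: "\<Psi> n (complex_of_real x) = 0 \<longleftrightarrow> cauchy 1 (monom 1 (?e n) * q) (x ^ 3) = 0"
    "\<Psi> (Suc n) (complex_of_real x) = 0 \<longleftrightarrow> cauchy 1 (monom 1 (?e (Suc n)) * q') (x ^ 3) = 0"
    if "x \<in> {-b<..<-a}" for x
    using neg[OF that] by (intro Pz; simp)+
  show ?thesis
  \<comment> \<open>For n < 2 both reduced polynomials are 1, so a pencil would contain 0; but here
    neither the polynomials nor the functions of second type have any zeros on the sets in
    question.\<close>
  proof (cases "n < 2")
    case True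
    then have "degree q = 0" "degree q' = 0" using q(4) q'(4) by auto
    then have "q = 1" "q' = 1" using q(3) q'(3) by (auto elim!: degree_eq_zeroE)
    then have Q: "poly q y \<noteq> 0" "poly q' y \<noteq> 0"
      and C: "y < 0 \<Longrightarrow> cauchy 1 (monom 1 (?e n) * q) y \<noteq> 0" "y < 0 \<Longrightarrow> cauchy 1 (monom 1 (?e (Suc n)) * q') y \<noteq> 0" for y
      using cauchy_one_nonzero by simp_all
    have none: "\<not> consec_zeros u I x y" if "\<And>t. t \<in> I \<Longrightarrow> u t \<noteq> 0" for u I x y
      using that by (auto simp: consec_zeros_def)
    have noneQ: "\<not> consec_zeros (\<lambda>t. poly (Q n) (complex_of_real t)) {0<..<\<alpha>} x y"
      "\<not> consec_zeros (\<lambda>t. poly (Q (Suc n)) (complex_of_real t)) {0<..<\<alpha>} x y" for x y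
      using Qr Q by (intro none; simp)+
    have none\<Psi>: "\<not> consec_zeros (\<lambda>t. \<Psi> n (complex_of_real t)) {-b<..<-a} x y"
      "\<not> consec_zeros (\<lambda>t. \<Psi> (Suc n) (complex_of_real t)) {-b<..<-a} x y" for x y
    proof -
      show "\<not> consec_zeros (\<lambda>t. \<Psi> n (complex_of_real t)) {-b<..<-a} x y"
      proof (rule none)
        fix t assume t: "t \<in> {-b<..<-a}"
        show "\<Psi> n (complex_of_real t) \<noteq> 0" unfolding Pr(1)[OF t] by (rule C(1)[OF neg(2)[OF t]])
      qed
      show "\<not> consec_zeros (\<lambda>t. \<Psi> (Suc n) (complex_of_real t)) {-b<..<-a} x y"
      proof (rule none)
        fix t assume t: "t \<in> {-b<..<-a}"
        show "\<Psi> (Suc n) (complex_of_real t) \<noteq> 0" unfolding Pr(2)[OF t] by (rule C(2)[OF neg(2)[OF t]])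
      qed
    qed
    show ?thesis
    proof (intro conjI ballI)
      fix z assume z: "z \<in> S0 \<alpha> - {0}"
      then obtain x where "0 < x" "z ^ 3 = complex_of_real (x ^ 3)" by (rule S0_E)
      with z Qz(1)[of z "x ^ 3"] Q(1)[of "x ^ 3"] show "\<not> (poly (Q n) z = 0 \<and> poly (Q (Suc n)) z = 0)" by blast
    next
      fix z assume "z \<in> S1 a b"
      then obtain x where x: "x < 0" "z ^ 3 = complex_of_real (x ^ 3)" "z \<noteq> 0" by (rule S1_E)
      then have "x ^ 3 < 0" by simp
      with Pz(1)[OF x(2,3)] C(1) show "\<not> (\<Psi> n z = 0 \<and> \<Psi> (Suc n) z = 0)" by blast
    qed (simp_all add: noneQ none\<Psi>)
  next
    case False
    then have n: "2 \<le> n" by simp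
    obtain e p where nd: "no_double_zeros e p q'" and p: "\<And>x. x > 0 \<Longrightarrow> poly q x = 0 \<longleftrightarrow> poly p x = 0"
      and cp: "\<And>z. z < 0 \<Longrightarrow> cauchy 1 (monom 1 (?e n) * q) z = 0 \<longleftrightarrow> cauchy 1 (monom 1 e * p) z = 0"
      and cq: "\<And>z. z < 0 \<Longrightarrow> cauchy 1 (monom 1 (?e (Suc n)) * q') z = 0 \<longleftrightarrow> cauchy 1 (monom 1 e * q') z = 0"
      by (fact adjacent_pencil[OF q(2-4) q'(2-4) n])
    note no_common = no_double_zeros_no_common[OF nd]
    have Qr': "poly (Q n) (complex_of_real x) = 0 \<longleftrightarrow> poly p (x ^ 3) = 0" if "x \<in> {0<..<\<alpha>}" for x
      using Qr(1)[OF that] p[of "x ^ 3"] that by simp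
    have Pr': "\<Psi> n (complex_of_real x) = 0 \<longleftrightarrow> cauchy 1 (monom 1 e * p) (x ^ 3) = 0"
      "\<Psi> (Suc n) (complex_of_real x) = 0 \<longleftrightarrow> cauchy 1 (monom 1 e * q') (x ^ 3) = 0" if "x \<in> {-b<..<-a}" for x
      using Pr[OF that] cp[of "x ^ 3"] cq[of "x ^ 3"] neg[OF that] by simp_all
    show ?thesis
    proof (intro conjI ballI allI impI)
      fix z assume z: "z \<in> S0 \<alpha> - {0}"
      then obtain x where "0 < x" "z ^ 3 = complex_of_real (x ^ 3)" by (rule S0_E)
      with z Qz[of z "x ^ 3"] no_common(1) p[of "x ^ 3"] show "\<not> (poly (Q n) z = 0 \<and> poly (Q (Suc n)) z = 0)" by auto
    next
      fix z assume "z \<in> S1 a b"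
      then obtain x where x: "x < 0" "z ^ 3 = complex_of_real (x ^ 3)" "z \<noteq> 0" by (rule S1_E)
      then have "x ^ 3 < 0" by simp
      with Pz[OF x(2,3)] no_common(2) cp cq show "\<not> (\<Psi> n z = 0 \<and> \<Psi> (Suc n) z = 0)" by blast
    next
      fix x y assume "consec_zeros (\<lambda>t. poly (Q n) (complex_of_real t)) {0<..<\<alpha>} x y"
      then show "\<exists>!z. x < z \<and> z < y \<and> poly (Q (Suc n)) (complex_of_real z) = 0"
        by (rule interlacing_poly[where u = "\<lambda>t. poly (Q n) (complex_of_real t)" and v = "\<lambda>t. poly (Q (Suc n)) (complex_of_real t)", OF nd, rotated 2]) (rule Qr' Qr(2); assumption)+
    next
      fix x y assume "consec_zeros (\<lambda>t. poly (Q (Suc n)) (complex_of_real t)) {0<..<\<alpha>} x y"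
      then show "\<exists>!z. x < z \<and> z < y \<and> poly (Q n) (complex_of_real z) = 0"
        by (rule interlacing_poly[where u = "\<lambda>t. poly (Q (Suc n)) (complex_of_real t)" and v = "\<lambda>t. poly (Q n) (complex_of_real t)", OF no_double_zeros_sym[OF nd], rotated 2]) (rule Qr' Qr(2); assumption)+
    next
      fix x y assume "consec_zeros (\<lambda>t. \<Psi> n (complex_of_real t)) {-b<..<-a} x y"
      then show "\<exists>!z. x < z \<and> z < y \<and> \<Psi> (Suc n) (complex_of_real z) = 0"
        by (rule interlacing_cauchy[where u = "\<lambda>t. \<Psi> n (complex_of_real t)" and v = "\<lambda>t. \<Psi> (Suc n) (complex_of_real t)", OF nd, rotated 2]) (rule Pr'; assumption)+
    next
      fix x y assume "consec_zeros (\<lambda>t. \<Psi> (Suc n) (complex_of_real t)) {-b<..<-a} x y"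
      then show "\<exists>!z. x < z \<and> z < y \<and> \<Psi> n (complex_of_real z) = 0"
        by (rule interlacing_cauchy[where u = "\<lambda>t. \<Psi> (Suc n) (complex_of_real t)" and v = "\<lambda>t. \<Psi> n (complex_of_real t)", OF no_double_zeros_sym[OF nd], rotated 2]) (rule Pr'; assumption)+
    qed
  qed
qed

end

theorem theorem1p4:
  fixes \<alpha> a b :: real and s1 s2 :: "real \<Rightarrow> real"
  assumes "0 < \<alpha>" and "0 < a" and "a < b"
    and "\<forall>x\<in>{0<..<\<alpha>}. s1 x \<ge> 0"
    and "set_integrable lborel {0<..<\<alpha>} s1"
    and "\<not> (AE x in lborel. x \<in> {0<..<\<alpha>} \<longrightarrow> s1 x = 0)"
    and "\<forall>t\<in>{-b..-a}. s2 t \<ge> 0"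
    and "set_integrable lborel {-b..-a} s2"
    and "\<not> (AE t in lborel. t \<in> {-b..-a} \<longrightarrow> s2 t = 0)"
  defines "Q \<equiv> Qpoly \<alpha> s1 (fM a b s2)"
    and "\<Psi> \<equiv> Psi \<alpha> s1 (fM a b s2)"
  shows "\<forall>n::nat.
     (\<forall>z \<in> S0 \<alpha> - {0}. \<not> (poly (Q n) z = 0 \<and> poly (Q (Suc n)) z = 0)) \<and>
     (\<forall>x y. consec_zeros (\<lambda>t. poly (Q n) (complex_of_real t)) {0<..<\<alpha>} x y \<longrightarrow>
        (\<exists>!z. x < z \<and> z < y \<and> poly (Q (Suc n)) (complex_of_real z) = 0)) \<and>
     (\<forall>x y. consec_zeros (\<lambda>t. poly (Q (Suc n)) (complex_of_real t)) {0<..<\<alpha>} x y \<longrightarrow>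
        (\<exists>!z. x < z \<and> z < y \<and> poly (Q n) (complex_of_real z) = 0)) \<and>
     (\<forall>z \<in> S1 a b. \<not> (\<Psi> n z = 0 \<and> \<Psi> (Suc n) z = 0)) \<and>
     (\<forall>x y. consec_zeros (\<lambda>t. \<Psi> n (complex_of_real t)) {-b<..<-a} x y \<longrightarrow>
        (\<exists>!z. x < z \<and> z < y \<and> \<Psi> (Suc n) (complex_of_real z) = 0)) \<and>
     (\<forall>x y. consec_zeros (\<lambda>t. \<Psi> (Suc n) (complex_of_real t)) {-b<..<-a} x y \<longrightarrow>
        (\<exists>!z. x < z \<and> z < y \<and> \<Psi> n (complex_of_real z) = 0))"
proof -
  interpret star_system \<alpha> a b s1 s2 by unfold_locales (use assms in simp_all)
  show ?thesis unfolding Q_def \<Psi>_def using zeros_interlace by blast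
qed

end
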